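(* Let $(\mathcal{X},d)$ be a finite metric space and let $\lambda_x>0$ be an arrival rate for each $x\in\mathcal{X}$. For MPMD in the Poisson arrival model with these rates, the Greedy algorithm achieves a ratio of expectations of $16/(1-e^{-2})$, i.e. $$\limsup_{m\to\infty}\frac{\mathbb{E}^m_\sigma[\mathrm{Greedy}(\sigma)]}{\mathbb{E}^m_\sigma[\mathrm{OPT}(\sigma)]}\le \frac{16}{1-e^{-2}}.$$
   Context: MPMD (Min-cost Perfect Matching with Delays) on a finite metric space $(\mathcal{X},d)$: the input is a sequence $\sigma$ of $m$ requests ($m$ even), each request $r$ having a location $\ell(r)\in\mathcal{X}$ and an arrival time $t(r)\ge 0$ (all distinct). A solution partitions the requests into pairs and assigns to each request a matching time $s(r)\ge t(r)$, with $s(r)=s(r')$ for matched pairs $(r,r')$ (so $s(r)\ge\max\{t(r),t(r')\}$). Its cost is $\sum_{(r,r')\text{ matched}} d(\ell(r),\ell(r'))+\sum_{r}(s(r)-t(r))$. An online algorithm decides at time $t$ to match a pair using only the requests arrived by time $t$, and decisions are irrevocable. $\mathrm{OPT}(\sigma)$ is the minimum cost of any (offline) solution. Poisson arrival model: for each $x\in\mathcal{X}$ requests arrive at $x$ according to independent Poisson processes of rate $\lambda_x>0$; equivalently, the waiting times between consecutive requests (over the whole space) are i.i.d. exponential with parameter $\lambda(\mathcal{X}):=\sum_{x\in\mathcal{X}}\lambda_x$ and each request is located at $x$ independently with probability $\lambda_x/\lambda(\mathcal{X})$, independently of the waiting times. A random sequence of length $m$ consists of $m$ requests generated this way; $\mathbb{E}^m_\sigma$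 denotes expectation over it. The Greedy algorithm: at any time $t$, if there exist two pending (unmatched, already arrived) requests $r,r'$ with $(t-t(r))+(t-t(r'))\ge d(\ell(r),\ell(r'))$, match them (ties broken arbitrarily). *)

theory Defs
  imports "HOL-Probability.Probability"
begin

text \<open>A request sequence is a list of (location, arrival time); requests are referred to by their
  position in the list.\<close>

type_synonym 'a requests = "('a \<times> real) list"

abbreviation loc :: "'a requests \<Rightarrow> nat \<Rightarrow> 'a" where
  "loc \<sigma> i \<equiv> fst (\<sigma> ! i)"

abbreviation arr :: "'a requests \<Rightarrow> nat \<Rightarrow> real" where
  "arr \<sigma> i \<equiv> snd (\<sigma> ! i)"

definition mpmd_input :: "'a set \<Rightarrow> 'a requests \<Rightarrow> bool" where
  "mpmd_input X \<sigma> \<longleftrightarrow>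
     even (length \<sigma>) \<and> (\<forall>i < length \<sigma>. loc \<sigma> i \<in> X \<and> 0 \<le> arr \<sigma> i) \<and>
     inj_on (arr \<sigma>) {..<length \<sigma>}"

text \<open>A pair of matched requests is represented once, with the smaller index first.\<close>

definition perfect_matching_on :: "nat set \<Rightarrow> (nat \<times> nat) set \<Rightarrow> bool" where
  "perfect_matching_on U M \<longleftrightarrow>
     M \<subseteq> {(i, j). i \<in> U \<and> j \<in> U \<and> i < j} \<and>
     (\<forall>k \<in> U. \<exists>!p. p \<in> M \<and> (k = fst p \<or> k = snd p))"

text \<open>A solution consists of the matched pairs and the matching times.\<close>

type_synonym solution = "(nat \<times> nat) set \<times> (nat \<Rightarrow> real)"

definition mpmd_solution :: "'a requests \<Rightarrow> solution \<Rightarrow> bool" where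
  "mpmd_solution \<sigma> = (\<lambda>(M, s).
     perfect_matching_on {..<length \<sigma>} M \<and>
     (\<forall>i < length \<sigma>. arr \<sigma> i \<le> s i) \<and>
     (\<forall>(i, j) \<in> M. s i = s j))"

definition mpmd_cost :: "('a \<Rightarrow> 'a \<Rightarrow> real) \<Rightarrow> 'a requests \<Rightarrow> solution \<Rightarrow> real" where
  "mpmd_cost d \<sigma> = (\<lambda>(M, s).
     (\<Sum>(i, j) \<in> M. d (loc \<sigma> i) (loc \<sigma> j)) + (\<Sum>i < length \<sigma>. s i - arr \<sigma> i))"

text \<open>The infimum is a minimum, see \<open>OPT_attained\<close> and \<open>OPT_le\<close> below.\<close>

definition OPT :: "('a \<Rightarrow> 'a \<Rightarrow> real) \<Rightarrow> 'a requests \<Rightarrow> real" where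
  "OPT d \<sigma> = (INF S \<in> {S. mpmd_solution \<sigma> S}. mpmd_cost d \<sigma> S)"

text \<open>The solutions that Greedy may output, over all ways of breaking ties: a pair is matched only
  when its joint waiting time has reached its distance, and once the matches of time \<open>\<tau>\<close> have been
  made, no two requests that are still pending meet this condition at time \<open>\<tau>\<close>.\<close>

definition greedy_solution :: "('a \<Rightarrow> 'a \<Rightarrow> real) \<Rightarrow> 'a requests \<Rightarrow> solution \<Rightarrow> bool" where
  "greedy_solution d \<sigma> = (\<lambda>(M, s).
     mpmd_solution \<sigma> (M, s) \<and>
     (\<forall>(i, j) \<in> M. (s i - arr \<sigma> i) + (s j - arr \<sigma> j) \<ge> d (loc \<sigma> i) (loc \<sigma> j)) \<and>
     (\<forall>\<tau>. \<not> (\<exists>i < length \<sigma>. \<exists>j < length \<sigma>. i \<noteq> j \<and>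
        arr \<sigma> i \<le> \<tau> \<and> \<tau> < s i \<and> arr \<sigma> j \<le> \<tau> \<and> \<tau> < s j \<and>
        (\<tau> - arr \<sigma> i) + (\<tau> - arr \<sigma> j) \<ge> d (loc \<sigma> i) (loc \<sigma> j))))"

text \<open>Poisson arrivals: \<open>fst (\<omega> i)\<close> is the waiting time before request \<open>i\<close>, \<open>snd (\<omega> i)\<close> its
  location.\<close>

definition poisson_arrivals :: "'a set \<Rightarrow> ('a \<Rightarrow> real) \<Rightarrow> nat \<Rightarrow> (nat \<Rightarrow> real \<times> 'a) measure" where
  "poisson_arrivals X rate m =
     (\<Pi>\<^sub>M i\<in>{..<m}. density lborel (\<lambda>w. ennreal (exponential_density (\<Sum>x\<in>X. rate x) w)) \<Otimes>\<^sub>M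
        point_measure X (\<lambda>x. ennreal (rate x / (\<Sum>y\<in>X. rate y))))"

definition request_seq :: "nat \<Rightarrow> (nat \<Rightarrow> real \<times> 'a) \<Rightarrow> 'a requests" where
  "request_seq m \<omega> = map (\<lambda>i. (snd (\<omega> i), \<Sum>j\<le>i. fst (\<omega> j))) [0..<m]"

text \<open>Breaking ties differently changes the Greedy cost on a null set only, but may make it
  non-measurable. The nonnegative integral gives the same value as over the completed measure
  (\<open>nn_integral_completion\<close>), hence is the expectation of the Greedy cost for every tie-breaking
  rule.\<close>

definition expected :: "'a set \<Rightarrow> ('a \<Rightarrow> real) \<Rightarrow> nat \<Rightarrow> ('a requests \<Rightarrow> real) \<Rightarrow> ennreal" where
  "expected X rate m f =
     (\<integral>\<^sup>+ \<omega>. ennreal (f (request_seq m \<omega>)) \<partial>poisson_arrivals X rate m)"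

lemma prob_space_poisson_arrivals:
  assumes "finite X" "X \<noteq> {}" "\<And>x. x \<in> X \<Longrightarrow> rate x > 0"
  shows "prob_space (poisson_arrivals X rate m)"
proof -
  have pos: "(\<Sum>x\<in>X. rate x) > 0"
    using assms by (simp add: sum_pos)
  have "(\<Sum>x\<in>X. rate x / (\<Sum>y\<in>X. rate y)) = 1"
    using pos by (simp flip: sum_divide_distrib)
  then have "prob_space (point_measure X (\<lambda>x. ennreal (rate x / (\<Sum>y\<in>X. rate y))))"
    using assms pos by (intro prob_space_point_measure) (auto simp: less_imp_le)
  then show ?thesis
    unfolding poisson_arrivals_def
    using prob_space_exponential_density[OF pos] by (intro prob_space_PiM prob_space_pair) auto
qed

lemma perfect_matching_on_insert:
  assumes M: "perfect_matching_on (U - {i, j}) M" and ij: "i \<in> U" "j \<in> U" "i < j"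
  shows "perfect_matching_on U (insert (i, j) M)"
proof -
  have sub: "M \<subseteq> {(a, b). a \<in> U - {i, j} \<and> b \<in> U - {i, j} \<and> a < b}"
    and ex: "\<And>k. k \<in> U - {i, j} \<Longrightarrow> \<exists>!p. p \<in> M \<and> (k = fst p \<or> k = snd p)"
    using M by (auto simp: perfect_matching_on_def)
  have "\<exists>!p. p \<in> insert (i, j) M \<and> (k = fst p \<or> k = snd p)" if "k \<in> U" for k
  proof (cases "k = i \<or> k = j")
    case True
    then show ?thesis using sub by (intro ex1I[of _ "(i, j)"]) auto
  next
    case False
    then have "\<exists>!p. p \<in> M \<and> (k = fst p \<or> k = snd p)"
      using that by (intro ex) auto
    moreover have "p \<in> insert (i, j) M \<and> (k = fst p \<or> k = snd p) \<longleftrightarrow>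
        p \<in> M \<and> (k = fst p \<or> k = snd p)" for p
      using False by auto
    ultimately show ?thesis by simp
  qed
  then show ?thesis using sub ij by (auto simp: perfect_matching_on_def)
qed

text \<open>Greedy always produces a solution: among the unmatched requests (arrived or not), repeatedly
  match the pair whose joint waiting time reaches its distance first.\<close>

lemma greedy_solution_exists:
  assumes sym: "\<And>x y. d x y = d y x" and "even (length \<sigma>)"
  shows "\<exists>S. greedy_solution d \<sigma> S"
proof -
  define D where "D i j = d (loc \<sigma> i) (loc \<sigma> j)" for i j
  define T where "T i j = Max {arr \<sigma> i, arr \<sigma> j, (arr \<sigma> i + arr \<sigma> j + D i j) / 2}" for i j
  have Dsym: "D i j = D j i" for i j using sym by (simp add: D_def)
  have Tsym: "T i j = T j i" for i j
    by (simp add: T_def Dsym[of i j] insert_commute add.commute)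
  have "\<exists>M s. perfect_matching_on U M \<and> (\<forall>i\<in>U. arr \<sigma> i \<le> s i) \<and> (\<forall>(i, j) \<in> M. s i = s j) \<and>
      (\<forall>(i, j) \<in> M. (s i - arr \<sigma> i) + (s j - arr \<sigma> j) \<ge> D i j) \<and>
      (\<forall>\<tau>. \<forall>i\<in>U. \<forall>j\<in>U. i \<noteq> j \<longrightarrow> arr \<sigma> i \<le> \<tau> \<longrightarrow> \<tau> < s i \<longrightarrow> arr \<sigma> j \<le> \<tau> \<longrightarrow> \<tau> < s j \<longrightarrow>
         (\<tau> - arr \<sigma> i) + (\<tau> - arr \<sigma> j) < D i j)"
    if "finite U" "even (card U)" for U
    using that
  proof (induction "card U" arbitrary: U rule: less_induct)
    case less
    show ?case
    proof (cases "U = {}")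
      case True
      then show ?thesis by (intro exI[of _ "{}"]) (auto simp: perfect_matching_on_def)
    next
      case False
      define Q where "Q = {(i, j). i \<in> U \<and> j \<in> U \<and> i < j}"
      have "Q \<subseteq> U \<times> U" by (auto simp: Q_def)
      then have finQ: "finite Q" using less.prems(1) by (meson finite_SigmaI finite_subset)
      have "card U \<noteq> 0" "card U \<noteq> 1" using False less.prems by auto
      then have "card U \<ge> 2" by linarith
      then obtain a b where ab: "a \<in> U" "b \<in> U" "a \<noteq> b"
        by (metis card_le_Suc0_iff_eq less.prems(1) not_less_eq_eq numeral_2_eq_2)
      then have "(min a b, max a b) \<in> Q" by (auto simp: Q_def min_def max_def)
      then have "\<exists>p\<in>Q. \<forall>q\<in>Q. case_prod T p \<le> case_prod T q"
        using finQ arg_min_if_finite(1)[OF finQ] arg_min_least[OF finQ]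
        by (metis empty_iff)
      then obtain i j where ij: "i \<in> U" "j \<in> U" "i < j"
        and least: "\<And>k l. (k, l) \<in> Q \<Longrightarrow> T i j \<le> T k l"
        by (fastforce simp: Q_def)
      have least': "T i j \<le> T k l" if "k \<in> U" "l \<in> U" "k \<noteq> l" for k l
        using least[of k l] least[of l k] Tsym[of k l] that
        by (cases "k < l") (auto simp: Q_def)
      have "card (U - {i, j}) = card U - 2"
        using ij less.prems by (simp add: card_Diff_subset)
      then obtain M s where M: "perfect_matching_on (U - {i, j}) M"
        and s: "\<forall>k\<in>U - {i, j}. arr \<sigma> k \<le> s k" "\<forall>(k, l) \<in> M. s k = s l"
          "\<forall>(k, l) \<in> M. (s k - arr \<sigma> k) + (s l - arr \<sigma> l) \<ge> D k l"
          "\<forall>\<tau>. \<forall>k\<in>U - {i, j}. \<forall>l\<in>U - {i, j}. k \<noteq> l \<longrightarrow> arr \<sigma> k \<le> \<tau> \<longrightarrow> \<tau> < s k \<longrightarrow>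
             arr \<sigma> l \<le> \<tau> \<longrightarrow> \<tau> < s l \<longrightarrow> (\<tau> - arr \<sigma> k) + (\<tau> - arr \<sigma> l) < D k l"
        using less.hyps[of "U - {i, j}"] less.prems \<open>card U \<ge> 2\<close> by auto
      define s' where "s' = s(i := T i j, j := T i j)"
      have s'_ij: "s' i = T i j" "s' j = T i j" by (auto simp: s'_def)
      have s'_else: "s' k = s k" if "k \<noteq> i" "k \<noteq> j" for k using that by (simp add: s'_def)
      have Mne: "k \<noteq> i \<and> k \<noteq> j \<and> l \<noteq> i \<and> l \<noteq> j" if "(k, l) \<in> M" for k l
        using M that by (auto simp: perfect_matching_on_def)
      have T_ge: "arr \<sigma> i \<le> T i j" "arr \<sigma> j \<le> T i j" "(arr \<sigma> i + arr \<sigma> j + D i j) / 2 \<le> T i j"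
        unfolding T_def by (intro Max_ge; simp)+
      have pend: "(\<tau> - arr \<sigma> k) + (\<tau> - arr \<sigma> l) < D k l"
        if "k \<in> U" "l \<in> U" "k \<noteq> l" "arr \<sigma> k \<le> \<tau>" "\<tau> < s' k" "arr \<sigma> l \<le> \<tau>" "\<tau> < s' l" for \<tau> k l
      proof (cases "k \<in> {i, j} \<or> l \<in> {i, j}")
        case True
        then have "\<tau> < T i j" using that s'_ij by auto
        also have "\<dots> \<le> T k l" using least' that by auto
        finally show ?thesis using that by (auto simp: T_def less_max_iff_disj)
      next
        case False
        then show ?thesis using s(4) that s'_else by auto
      qed
      show ?thesis
      proof (intro exI[of _ "insert (i, j) M"] exI[of _ s'] conjI)
        show "perfect_matching_on U (insert (i, j) M)"
          by (rule perfect_matching_on_insert[OF M ij])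
        show "\<forall>k\<in>U. arr \<sigma> k \<le> s' k" using s(1) T_ge by (auto simp: s'_def)
        show "\<forall>(k, l)\<in>insert (i, j) M. s' k = s' l"
          using s(2) Mne s'_else s'_ij by fastforce
        have "D k l \<le> s' k - arr \<sigma> k + (s' l - arr \<sigma> l)" if "(k, l) \<in> M" for k l
          using s(3) Mne[OF that] s'_else that by auto
        then show "\<forall>(k, l)\<in>insert (i, j) M. D k l \<le> s' k - arr \<sigma> k + (s' l - arr \<sigma> l)"
          using T_ge(3) s'_ij by (auto simp: field_simps)
        show "\<forall>\<tau>. \<forall>k\<in>U. \<forall>l\<in>U. k \<noteq> l \<longrightarrow> arr \<sigma> k \<le> \<tau> \<longrightarrow> \<tau> < s' k \<longrightarrow> arr \<sigma> l \<le> \<tau> \<longrightarrow> \<tau> < s' l \<longrightarrow>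
            (\<tau> - arr \<sigma> k) + (\<tau> - arr \<sigma> l) < D k l"
          using pend by blast
      qed
    qed
  qed
  from this[of "{..<length \<sigma>}"] assms(2) obtain M s where
    "perfect_matching_on {..<length \<sigma>} M" "\<forall>i<length \<sigma>. arr \<sigma> i \<le> s i" "\<forall>(i, j) \<in> M. s i = s j"
    "\<forall>(i, j) \<in> M. (s i - arr \<sigma> i) + (s j - arr \<sigma> j) \<ge> D i j"
    "\<forall>\<tau>. \<forall>i<length \<sigma>. \<forall>j<length \<sigma>. i \<noteq> j \<longrightarrow> arr \<sigma> i \<le> \<tau> \<longrightarrow> \<tau> < s i \<longrightarrow> arr \<sigma> j \<le> \<tau> \<longrightarrow> \<tau> < s j \<longrightarrow>
         (\<tau> - arr \<sigma> i) + (\<tau> - arr \<sigma> j) < D i j"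
    by (auto simp: Ball_def)
  then have "greedy_solution d \<sigma> (M, s)"
    unfolding greedy_solution_def mpmd_solution_def D_def prod.case
    by (intro conjI; (assumption | meson not_le))
  then show ?thesis ..
qed

lemma OPT_attained_aux:
  assumes "even (length \<sigma>)"
  obtains S where "mpmd_solution \<sigma> S"
    "\<And>S'. mpmd_solution \<sigma> S' \<Longrightarrow> mpmd_cost d \<sigma> S \<le> mpmd_cost d \<sigma> S'"
proof -
  let ?n = "length \<sigma>"
  define pr where "pr M k = (THE p. p \<in> M \<and> (k = fst p \<or> k = snd p))" for M :: "(nat \<times> nat) set" and k
  define s where "s M k = max (arr \<sigma> (fst (pr M k))) (arr \<sigma> (snd (pr M k)))" for M k
  have ex1: "\<exists>!p. p \<in> M \<and> (k = fst p \<or> k = snd p)"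
    if "perfect_matching_on {..<?n} M" "k < ?n" for M k
    using that unfolding perfect_matching_on_def by (metis lessThan_iff)
  have pr: "pr M k \<in> M \<and> (k = fst (pr M k) \<or> k = snd (pr M k))"
    if "perfect_matching_on {..<?n} M" "k < ?n" for M k
    unfolding pr_def by (rule theI'[OF ex1[OF that]])
  have pr_eq: "pr M k = p"
    if "perfect_matching_on {..<?n} M" "k < ?n" "p \<in> M" "k = fst p \<or> k = snd p" for M k p
    unfolding pr_def by (rule the1_equality[OF ex1[OF that(1,2)] conjI[OF that(3,4)]])
  have bound: "i < ?n \<and> j < ?n" if "perfect_matching_on {..<?n} M" "(i, j) \<in> M" for M i j
    using that by (auto simp: perfect_matching_on_def)
  have sol: "mpmd_solution \<sigma> (M, s M)" if M: "perfect_matching_on {..<?n} M" for M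
  proof -
    have "arr \<sigma> k \<le> s M k" if "k < ?n" for k
      using pr[OF M that] by (auto simp: s_def)
    moreover have "s M i = s M j" if "(i, j) \<in> M" for i j
      using pr_eq[OF M _ that, of i] pr_eq[OF M _ that, of j] bound[OF M that] by (simp add: s_def)
    ultimately show ?thesis using M by (auto simp: mpmd_solution_def)
  qed
  have le: "mpmd_cost d \<sigma> (M, s M) \<le> mpmd_cost d \<sigma> (M, s')" if S: "mpmd_solution \<sigma> (M, s')" for M s'
  proof -
    have M: "perfect_matching_on {..<?n} M" using S by (simp add: mpmd_solution_def)
    have "s M k \<le> s' k" if k: "k < ?n" for k
    proof -
      obtain i j where ij: "pr M k = (i, j)" by (cases "pr M k")
      have p: "(i, j) \<in> M" "k = i \<or> k = j" using pr[OF M k] ij by auto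
      then have "s' i = s' j" "arr \<sigma> i \<le> s' i" "arr \<sigma> j \<le> s' j"
        using S bound[OF M p(1)] by (auto simp: mpmd_solution_def)
      then show ?thesis using p(2) by (auto simp: s_def ij)
    qed
    then show ?thesis by (auto simp: mpmd_cost_def intro!: sum_mono)
  qed
  let ?A = "{M. perfect_matching_on {..<?n} M}"
  have "?A \<subseteq> Pow ({..<?n} \<times> {..<?n})" by (auto simp: perfect_matching_on_def)
  then have fin: "finite ?A" by (rule finite_subset) simp
  obtain S0 where "greedy_solution (\<lambda>_ _. 0) \<sigma> S0"
    using greedy_solution_exists[of "\<lambda>_ _. 0" \<sigma>] assms by auto
  then have ne: "?A \<noteq> {}" by (auto simp: greedy_solution_def mpmd_solution_def)
  define M where "M = arg_min_on (\<lambda>M. mpmd_cost d \<sigma> (M, s M)) ?A"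
  have "M \<in> ?A" unfolding M_def by (rule arg_min_if_finite(1)[OF fin ne])
  moreover have "mpmd_cost d \<sigma> (M, s M) \<le> mpmd_cost d \<sigma> (M', s')" if "mpmd_solution \<sigma> (M', s')" for M' s'
  proof -
    have "M' \<in> ?A" using that by (simp add: mpmd_solution_def)
    then have "mpmd_cost d \<sigma> (M, s M) \<le> mpmd_cost d \<sigma> (M', s M')"
      unfolding M_def using fin ne by (intro arg_min_least[of ?A M' "\<lambda>M. mpmd_cost d \<sigma> (M, s M)"]) auto
    then show ?thesis using le[OF that] by linarith
  qed
  ultimately show thesis using sol[of M] that[of "(M, s M)"] by force
qed

lemma OPT_le:
  assumes "even (length \<sigma>)" "mpmd_solution \<sigma> S"
  shows "OPT d \<sigma> \<le> mpmd_cost d \<sigma> S"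
proof -
  obtain S0 where "\<And>S'. mpmd_solution \<sigma> S' \<Longrightarrow> mpmd_cost d \<sigma> S0 \<le> mpmd_cost d \<sigma> S'"
    using OPT_attained_aux[OF assms(1)] by metis
  then show ?thesis
    unfolding OPT_def using assms(2) by (intro cINF_lower bdd_belowI2) auto
qed

lemma OPT_attained:
  assumes "even (length \<sigma>)"
  shows "\<exists>S. mpmd_solution \<sigma> S \<and> OPT d \<sigma> = mpmd_cost d \<sigma> S"
proof -
  obtain S where S: "mpmd_solution \<sigma> S"
    "\<And>S'. mpmd_solution \<sigma> S' \<Longrightarrow> mpmd_cost d \<sigma> S \<le> mpmd_cost d \<sigma> S'"
    using OPT_attained_aux[OF assms] by metis
  then have "mpmd_cost d \<sigma> S \<le> OPT d \<sigma>"
    unfolding OPT_def by (intro cINF_greatest) blast+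
  then show ?thesis using OPT_le[OF assms S(1)] S(1) by (intro exI[of _ S]) (auto intro: antisym)
qed

end

theory Submission
  imports Defs "HOL-Real_Asymp.Real_Asymp"
begin

text \<open>Let \<open>\<rho> x\<close> be the radius at which the expected number of arrivals in the ball around \<open>x\<close> during
  a time interval of length \<open>\<rho> x\<close> crosses 1. Once a request at \<open>x\<close> has waited for more than \<open>\<rho> x\<close>,
  Greedy matches it no later than at the next arrival within distance \<open>\<rho> x\<close>: if that arrival were
  matched to a third request, the triangle inequality would have allowed matching the third request
  with \<open>x\<close> before. Hence the expected waiting time is at most \<open>2 * \<rho> x\<close>, up to at most \<open>card X\<close>
  requests that are pending after the last arrival, and the connection cost is at most the waiting
  cost. Conversely, a request at \<open>x\<close> costs every solution at least half the minimal space-time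
  distance to another request, which exceeds \<open>u < \<rho> x\<close> with probability at least \<open>exp (- 2 * u / \<rho> x)\<close>.\<close>

section \<open>Greedy and optimal solutions on a fixed request sequence\<close>

text \<open>The constant is (2 * 2) / (1/2 * 1/2 * (1 - exp (- 2))). Per request, Greedy waits
  \<open>rho\<close> up to a deadline and on average at most another \<open>rho\<close> beyond it;
  the connection cost doubles this. For the optimum, one factor 1/2 arises because a matched pair is
  charged by both of its requests, and the integral of \<open>exp (- 2 * u / rho)\<close> over u
  from 0 to \<open>rho\<close> is \<open>rho * (1 - exp (- 2)) / 2\<close>. The 2 in the exponent is
  there because isolation concerns both earlier and later requests. The number of requests is fixed,
  not the duration, so the number of arrivals in a time window is not exactly Poisson. Each request
  therefore carries a potential that is updated arrival by arrival: a supermartingale for the wait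
  under Greedy, a submartingale for the isolation probability. Truncating the sequence can only help
  isolation; for Greedy it leaves an additive constant that vanishes in the limit. The Greedy cost
  may be non-measurable, so it is bounded pointwise by measurable quantities before anything is
  computed.\<close>

lemma sum_perfect_matching:
  fixes f :: "nat \<Rightarrow> 'b::comm_monoid_add"
  assumes M: "perfect_matching_on U M" and "finite U"
  shows "(\<Sum>k\<in>U. f k) = (\<Sum>(i, j)\<in>M. f i + f j)"
proof -
  have sub: "M \<subseteq> U \<times> U" and lt: "\<And>i j. (i, j) \<in> M \<Longrightarrow> i < j"
    and ex1: "\<And>k. k \<in> U \<Longrightarrow> \<exists>!p. p \<in> M \<and> (k = fst p \<or> k = snd p)"
    using M by (auto simp: perfect_matching_on_def)
  have finM: "finite M" using sub \<open>finite U\<close> by (meson finite_SigmaI finite_subset)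
  have U: "U = (\<Union>p\<in>M. {fst p, snd p})"
  proof (intro equalityI subsetI)
    show "k \<in> (\<Union>p\<in>M. {fst p, snd p})" if "k \<in> U" for k
      using ex1[OF that] by blast
    show "k \<in> U" if "k \<in> (\<Union>p\<in>M. {fst p, snd p})" for k
      using that sub by auto
  qed
  have disj: "\<forall>p\<in>M. \<forall>q\<in>M. p \<noteq> q \<longrightarrow> {fst p, snd p} \<inter> {fst q, snd q} = {}"
  proof (intro ballI impI)
    fix p q assume pq: "p \<in> M" "q \<in> M" "p \<noteq> q"
    show "{fst p, snd p} \<inter> {fst q, snd q} = {}"
    proof (rule ccontr)
      assume "{fst p, snd p} \<inter> {fst q, snd q} \<noteq> {}"
      then obtain k where k: "k = fst p \<or> k = snd p" "k = fst q \<or> k = snd q" by auto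
      then have "k \<in> U" using pq U by auto
      with ex1 k pq show False by metis
    qed
  qed
  have "(\<Sum>k\<in>U. f k) = (\<Sum>p\<in>M. \<Sum>k\<in>{fst p, snd p}. f k)"
    by (subst U, rule sum.UNION_disjoint) (use finM disj in auto)
  also have "\<dots> = (\<Sum>(i, j)\<in>M. f i + f j)"
    by (intro sum.cong refl) (auto split: prod.split dest!: lt)
  finally show ?thesis .
qed

lemma perfect_matching_partner:
  assumes "perfect_matching_on U M" "k \<in> U"
  obtains j where "j \<in> U" "j \<noteq> k" "(k, j) \<in> M \<or> (j, k) \<in> M"
proof -
  from assms obtain p where p: "p \<in> M" "k = fst p \<or> k = snd p"
    unfolding perfect_matching_on_def by blast
  moreover have "M \<subseteq> {(i, j). i \<in> U \<and> j \<in> U \<and> i < j}"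
    using assms(1) unfolding perfect_matching_on_def by blast
  then have "fst p \<in> U \<and> snd p \<in> U \<and> fst p < snd p" using p(1) by auto
  ultimately show thesis
    using that[of "fst p"] that[of "snd p"] by (cases p) fastforce
qed

text \<open>For increasing \<open>t\<close>, \<open>excess t x B b i n\<close> is the time from \<open>b\<close> until the first later arrival in \<open>B\<close>
  among the requests \<open>i < k < n\<close>, or until \<open>t (n - 1)\<close> if there is none; it is written as a sum over
  arrivals so that it can be revealed one arrival at a time.\<close>

definition missed ::
    "(nat \<Rightarrow> real) \<Rightarrow> (nat \<Rightarrow> 'a) \<Rightarrow> 'a set \<Rightarrow> real \<Rightarrow> nat \<Rightarrow> nat \<Rightarrow> bool" where
  "missed t x B b i n \<longleftrightarrow> (\<forall>l<n. i < l \<longrightarrow> x l \<in> B \<longrightarrow> t l \<le> b)"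

definition excess ::
    "(nat \<Rightarrow> real) \<Rightarrow> (nat \<Rightarrow> 'a) \<Rightarrow> 'a set \<Rightarrow> real \<Rightarrow> nat \<Rightarrow> nat \<Rightarrow> real" where
  "excess t x B b i n =
     (\<Sum>k\<in>{i<..<n}. if missed t x B b i k then max 0 (t k - max (t (k - 1)) b) else 0)"

lemma missed_Suc:
  "missed t x B b i (Suc n) \<longleftrightarrow> missed t x B b i n \<and> (i < n \<longrightarrow> x n \<in> B \<longrightarrow> t n \<le> b)"
  by (auto simp: missed_def less_Suc_eq)

lemma excess_Suc:
  assumes "i < n"
  shows "excess t x B b i (Suc n) = excess t x B b i n +
     (if missed t x B b i n then max 0 (t n - max (t (n - 1)) b) else 0)"
proof -
  have "{i<..<Suc n} = insert n {i<..<n}" using assms by auto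
  then show ?thesis by (simp add: excess_def add.commute)
qed

lemma excess_start [simp]: "excess t x B b i (Suc i) = 0"
proof -
  have "{i<..<Suc i} = {}" by auto
  then show ?thesis by (simp add: excess_def)
qed

lemma missed_start [simp]: "missed t x B b i (Suc i)"
  by (auto simp: missed_def)

lemma excess_nonneg: "0 \<le> excess t x B b i n"
  unfolding excess_def by (intro sum_nonneg) auto

text \<open>While no arrival has hit \<open>B\<close> after \<open>b\<close>, the summands telescope
  to the time elapsed since \<open>b\<close>. The summand of the hitting arrival is still included,
  because \<open>missed\<close> looks only at strictly earlier indices; so the sum has reached
  \<open>c - b\<close> by then, and later summands cannot decrease it. In the application
  \<open>c\<close> is the matching time of request \<open>i\<close>.\<close>

lemma excess_lower_bound:
  assumes mono: "\<And>k. i < k \<Longrightarrow> k < m \<Longrightarrow> t (k - 1) \<le> t k"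
    and hit: "\<And>k. i < k \<Longrightarrow> k < m \<Longrightarrow> x k \<in> B \<Longrightarrow> b < t k \<Longrightarrow> c \<le> t k"
    and "t i \<le> b" "i < n" "n \<le> m"
  shows "(missed t x B b i n \<and> excess t x B b i n = max 0 (t (n - 1) - b)) \<or>
     c - b \<le> excess t x B b i n"
  using \<open>i < n\<close> \<open>n \<le> m\<close>
proof (induction n)
  case (Suc n)
  show ?case
  proof (cases "i = n")
    case True
    then show ?thesis using \<open>t i \<le> b\<close> by simp
  next
    case False
    then have n: "i < n" "n < m" using Suc.prems by auto
    have "excess t x B b i n \<le> excess t x B b i (Suc n)"
      by (simp add: excess_Suc[OF n(1)])
    moreover have "missed t x B b i (Suc n) \<and> excess t x B b i (Suc n) = max 0 (t n - b) \<or>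
        c - b \<le> excess t x B b i (Suc n)"
      if miss: "missed t x B b i n" and ex: "excess t x B b i n = max 0 (t (n - 1) - b)"
    proof -
      have eq: "excess t x B b i (Suc n) = max 0 (t n - b)"
        using miss ex mono[OF n] by (auto simp: excess_Suc[OF n(1)] max_def)
      show ?thesis
      proof (cases "x n \<in> B \<and> b < t n")
        case True
        then show ?thesis using hit[OF n] eq by auto
      next
        case False
        then show ?thesis using miss eq by (auto simp: missed_Suc)
      qed
    qed
    ultimately show ?thesis using Suc.IH n by auto
  qed
qed simp

section \<open>Pathwise bounds for Greedy and for the optimum\<close>

lemma greedy_solutionD:
  assumes G: "greedy_solution d \<sigma> (M, s)"
  shows "perfect_matching_on {..<length \<sigma>} M"
    and "j < length \<sigma> \<Longrightarrow> arr \<sigma> j \<le> s j"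
    and "(a, b) \<in> M \<Longrightarrow> s a = s b"
    and "(a, b) \<in> M \<Longrightarrow> d (loc \<sigma> a) (loc \<sigma> b) \<le> (s a - arr \<sigma> a) + (s b - arr \<sigma> b)"
    and "a < length \<sigma> \<Longrightarrow> b < length \<sigma> \<Longrightarrow> a \<noteq> b \<Longrightarrow> arr \<sigma> a \<le> \<tau> \<Longrightarrow> \<tau> < s a \<Longrightarrow>
        arr \<sigma> b \<le> \<tau> \<Longrightarrow> \<tau> < s b \<Longrightarrow> (\<tau> - arr \<sigma> a) + (\<tau> - arr \<sigma> b) < d (loc \<sigma> a) (loc \<sigma> b)"
proof -
  show "perfect_matching_on {..<length \<sigma>} M" and "j < length \<sigma> \<Longrightarrow> arr \<sigma> j \<le> s j"
    and "(a, b) \<in> M \<Longrightarrow> s a = s b"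
    and "(a, b) \<in> M \<Longrightarrow> d (loc \<sigma> a) (loc \<sigma> b) \<le> (s a - arr \<sigma> a) + (s b - arr \<sigma> b)"
    using G unfolding greedy_solution_def mpmd_solution_def by auto
  have "\<not> (\<exists>i < length \<sigma>. \<exists>j < length \<sigma>. i \<noteq> j \<and>
      arr \<sigma> i \<le> \<tau> \<and> \<tau> < s i \<and> arr \<sigma> j \<le> \<tau> \<and> \<tau> < s j \<and>
      (\<tau> - arr \<sigma> i) + (\<tau> - arr \<sigma> j) \<ge> d (loc \<sigma> i) (loc \<sigma> j))"
    using G unfolding greedy_solution_def by blast
  then show "a < length \<sigma> \<Longrightarrow> b < length \<sigma> \<Longrightarrow> a \<noteq> b \<Longrightarrow> arr \<sigma> a \<le> \<tau> \<Longrightarrow> \<tau> < s a \<Longrightarrow>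
      arr \<sigma> b \<le> \<tau> \<Longrightarrow> \<tau> < s b \<Longrightarrow> (\<tau> - arr \<sigma> a) + (\<tau> - arr \<sigma> b) < d (loc \<sigma> a) (loc \<sigma> b)"
    by (meson not_le)
qed

text \<open>If \<open>i\<close> were still pending after \<open>k\<close> arrives, \<open>k\<close>
  itself could not stay pending next to \<open>i\<close>, so it would be matched at once to some
  \<open>j\<close>. As arrival times are distinct, \<open>j\<close> came strictly earlier, and
  \<open>i\<close> and \<open>j\<close> would have become matchable strictly before \<open>k\<close>
  arrived.\<close>

lemma greedy_matched_on_arrival:
  assumes "Metric_space X d" and G: "greedy_solution d \<sigma> (M, s)"
    and X: "\<And>j. j < length \<sigma> \<Longrightarrow> loc \<sigma> j \<in> X"
    and inj: "inj_on (arr \<sigma>) {..<length \<sigma>}"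
    and i: "i < length \<sigma>" and k: "k < length \<sigma>"
    and dist: "d (loc \<sigma> i) (loc \<sigma> k) \<le> r" and late: "arr \<sigma> i + r < arr \<sigma> k"
  shows "s i \<le> arr \<sigma> k"
proof (rule ccontr)
  interpret Metric_space X d by fact
  assume "\<not> s i \<le> arr \<sigma> k"
  then have si: "arr \<sigma> k < s i" by simp
  have r: "0 \<le> r" using dist nonneg order_trans by blast
  note M = greedy_solutionD(1)[OF G] and ge = greedy_solutionD(2)[OF G]
    and eq = greedy_solutionD(3)[OF G] and wait = greedy_solutionD(4)[OF G]
    and pend = greedy_solutionD(5)[OF G]
  have sk: "s k = arr \<sigma> k"
  proof (rule ccontr)
    assume "s k \<noteq> arr \<sigma> k"
    then have "arr \<sigma> k < s k" using ge[OF k] by simp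
    with pend[of i k "arr \<sigma> k"] i k si late r dist show False by force
  qed
  obtain j where j: "j < length \<sigma>" "j \<noteq> k" "(k, j) \<in> M \<or> (j, k) \<in> M"
    using perfect_matching_partner[OF M, of k] k by auto
  then have sj: "s j = arr \<sigma> k"
    and djk: "d (loc \<sigma> k) (loc \<sigma> j) \<le> arr \<sigma> k - arr \<sigma> j"
    using eq wait sk by (force simp: commute)+
  have "arr \<sigma> j \<noteq> arr \<sigma> k" using inj j k by (auto dest: inj_onD)
  then have jk: "arr \<sigma> j < arr \<sigma> k" using ge[OF j(1)] sj by simp
  \<comment> \<open>The joint wait of \<open>i\<close> and \<open>j\<close> must reach
    \<open>r + (arr \<sigma> k - arr \<sigma> j)\<close>, which bounds their distance via
    \<open>k\<close>; this happens at the midpoint of \<open>arr \<sigma> k\<close> and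
    \<open>arr \<sigma> i + r\<close>. The maximum ensures that \<open>j\<close> has arrived, and
    \<open>late\<close> keeps the time below \<open>arr \<sigma> k\<close>.\<close>
  define \<tau> where "\<tau> = max (arr \<sigma> j) ((arr \<sigma> k + arr \<sigma> i + r) / 2)"
  have \<tau>: "arr \<sigma> i \<le> \<tau>" "arr \<sigma> j \<le> \<tau>" "\<tau> < arr \<sigma> k" "arr \<sigma> k + arr \<sigma> i + r \<le> 2 * \<tau>"
    using jk late r unfolding \<tau>_def by (auto simp: max_def)
  have "i \<noteq> j" using si sj by auto
  then have "(\<tau> - arr \<sigma> i) + (\<tau> - arr \<sigma> j) < d (loc \<sigma> i) (loc \<sigma> j)"
    using pend[of i j \<tau>] i j \<tau> si sj by simp
  also have "\<dots> \<le> d (loc \<sigma> i) (loc \<sigma> k) + d (loc \<sigma> k) (loc \<sigma> j)"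
    using triangle X i j k by blast
  finally show False using djk dist \<tau> by linarith
qed

text \<open>Requests pending at \<open>T\<close> have pairwise different locations, since two at the
  same point are matchable at once; so there are at most \<open>card X\<close> of them. Each is gone
  by \<open>T + D\<close>: its partner is pending just as long, and by then their joint wait exceeds
  any distance.\<close>

lemma greedy_wait_after_last_arrival:
  assumes "Metric_space X d" "finite X" and G: "greedy_solution d \<sigma> (M, s)"
    and X: "\<And>j. j < length \<sigma> \<Longrightarrow> loc \<sigma> j \<in> X"
    and T: "\<And>j. j < length \<sigma> \<Longrightarrow> arr \<sigma> j \<le> T"
    and D: "\<And>x y. x \<in> X \<Longrightarrow> y \<in> X \<Longrightarrow> d x y \<le> D"
  shows "(\<Sum>i<length \<sigma>. max 0 (s i - T)) \<le> real (card X) * D"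
proof -
  interpret Metric_space X d by fact
  note M = greedy_solutionD(1)[OF G] and eq = greedy_solutionD(3)[OF G]
    and pend = greedy_solutionD(5)[OF G]
  define L where "L = {i. i < length \<sigma> \<and> T < s i}"
  have D0: "0 \<le> D" if "i < length \<sigma>" for i
    using D[OF X[OF that] X[OF that]] nonneg order_trans by blast
  have le: "s i \<le> T + D" if i: "i < length \<sigma>" for i
  proof (rule ccontr)
    assume "\<not> s i \<le> T + D"
    moreover obtain j where j: "j < length \<sigma>" "j \<noteq> i" "(i, j) \<in> M \<or> (j, i) \<in> M"
      using perfect_matching_partner[OF M, of i] i by auto
    moreover have "s j = s i" using eq j by fastforce
    ultimately have "(T + D - arr \<sigma> i) + (T + D - arr \<sigma> j) < d (loc \<sigma> i) (loc \<sigma> j)"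
      using pend[of i j "T + D"] i T D0[OF i] by force
    then show False
      using T[OF i] T[OF j(1)] D0[OF i] D[OF X[OF i] X[OF j(1)]] by linarith
  qed
  have "inj_on (loc \<sigma>) L"
  proof (rule inj_onI, rule ccontr)
    fix i j assume *: "i \<in> L" "j \<in> L" "loc \<sigma> i = loc \<sigma> j" "i \<noteq> j"
    then have "(T - arr \<sigma> i) + (T - arr \<sigma> j) < d (loc \<sigma> i) (loc \<sigma> j)"
      using pend[of i j T] T by (auto simp: L_def)
    moreover have "d (loc \<sigma> i) (loc \<sigma> j) = 0" using * X by (auto simp: L_def)
    ultimately show False using T * by (auto simp: L_def) (smt (verit))
  qed
  then have cardL: "card L \<le> card X"
    using X \<open>finite X\<close> by (intro card_inj_on_le[of "loc \<sigma>"]) (auto simp: L_def)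
  show ?thesis
  proof (cases "length \<sigma> = 0")
    case True
    have "0 \<le> real (card X) * D"
    proof (cases "X = {}")
      case False
      then obtain x where "x \<in> X" by auto
      then show ?thesis using D[of x x] nonneg[of x x] by (intro mult_nonneg_nonneg) linarith+
    qed simp
    then show ?thesis using True by simp
  next
    case False
    then have "0 \<le> D" using D0 by blast
    have "(\<Sum>i<length \<sigma>. max 0 (s i - T)) = (\<Sum>i\<in>L. max 0 (s i - T))"
      by (intro sum.mono_neutral_right) (auto simp: L_def)
    also have "\<dots> \<le> (\<Sum>i\<in>L. D)"
    proof (intro sum_mono)
      fix i assume "i \<in> L"
      then show "max 0 (s i - T) \<le> D" using le[of i] \<open>0 \<le> D\<close> by (auto simp: L_def)
    qed
    also have "\<dots> \<le> real (card X) * D"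
      using cardL \<open>0 \<le> D\<close> by (simp add: mult_right_mono)
    finally show ?thesis .
  qed
qed

lemma greedy_cost_le_wait:
  assumes "greedy_solution d \<sigma> (M, s)"
  shows "mpmd_cost d \<sigma> (M, s) \<le> 2 * (\<Sum>i<length \<sigma>. s i - arr \<sigma> i)"
proof -
  note M = greedy_solutionD(1)[OF assms] and wait = greedy_solutionD(4)[OF assms]
  have "(\<Sum>(i, j)\<in>M. d (loc \<sigma> i) (loc \<sigma> j)) \<le> (\<Sum>(i, j)\<in>M. (s i - arr \<sigma> i) + (s j - arr \<sigma> j))"
    by (intro sum_mono) (auto dest: wait)
  also have "\<dots> = (\<Sum>i<length \<sigma>. s i - arr \<sigma> i)"
    by (rule sum_perfect_matching[OF M, symmetric]) simp
  finally show ?thesis by (simp add: mpmd_cost_def)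
qed

lemma greedy_cost_le_excess:
  assumes metric: "Metric_space X d" "finite X" and G: "greedy_solution d \<sigma> (M, s)"
    and X: "\<And>j. j < length \<sigma> \<Longrightarrow> loc \<sigma> j \<in> X"
    and mono: "\<And>i j. i < j \<Longrightarrow> j < length \<sigma> \<Longrightarrow> arr \<sigma> i < arr \<sigma> j"
    and r: "\<And>x. x \<in> X \<Longrightarrow> 0 \<le> r x"
    and D: "\<And>x y. x \<in> X \<Longrightarrow> y \<in> X \<Longrightarrow> d x y \<le> D"
  shows "mpmd_cost d \<sigma> (M, s) \<le>
     2 * (\<Sum>i<length \<sigma>. r (loc \<sigma> i) + excess (arr \<sigma>) (loc \<sigma>) {y \<in> X. d (loc \<sigma> i) y \<le> r (loc \<sigma> i)}
            (arr \<sigma> i + r (loc \<sigma> i)) i (length \<sigma>)) + 2 * (real (card X) * D)"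
proof -
  let ?m = "length \<sigma>"
  let ?B = "\<lambda>i. {y \<in> X. d (loc \<sigma> i) y \<le> r (loc \<sigma> i)}"
  let ?b = "\<lambda>i. arr \<sigma> i + r (loc \<sigma> i)"
  define T where "T = arr \<sigma> (?m - 1)"
  have T: "arr \<sigma> j \<le> T" if "j < ?m" for j
  proof (cases "j = ?m - 1")
    case False
    then have "j < ?m - 1" "?m - 1 < ?m" using that by auto
    then show ?thesis unfolding T_def by (intro less_imp_le mono)
  qed (simp add: T_def)
  have inj: "inj_on (arr \<sigma>) {..<?m}"
    using mono by (intro inj_onI) (metis lessThan_iff less_irrefl nat_neq_iff)
  have wait: "s i - arr \<sigma> i \<le>
      (r (loc \<sigma> i) + excess (arr \<sigma>) (loc \<sigma>) (?B i) (?b i) i ?m) + max 0 (s i - T)" if i: "i < ?m" for i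
  proof -
    \<comment> \<open>If no arrival hits the ball after the deadline, the excess covers the time up
      to \<open>T\<close> and the term \<open>max 0 (s i - T)\<close> covers the rest. Otherwise the
      hit forces the match, and the excess alone covers the wait beyond the deadline.\<close>
    have "(missed (arr \<sigma>) (loc \<sigma>) (?B i) (?b i) i ?m \<and>
        excess (arr \<sigma>) (loc \<sigma>) (?B i) (?b i) i ?m = max 0 (arr \<sigma> (?m - 1) - ?b i)) \<or>
        s i - ?b i \<le> excess (arr \<sigma>) (loc \<sigma>) (?B i) (?b i) i ?m"
    proof (rule excess_lower_bound[where m = ?m])
      show "arr \<sigma> (k - 1) \<le> arr \<sigma> k" if "i < k" "k < ?m" for k
        using mono[of "k - 1" k] that by simp
      show "s i \<le> arr \<sigma> k" if "i < k" "k < ?m" "loc \<sigma> k \<in> ?B i" "?b i < arr \<sigma> k" for k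
        using that i by (intro greedy_matched_on_arrival[OF metric(1) G X inj, of i k "r (loc \<sigma> i)"]) auto
    qed (use i r X in auto)
    then show ?thesis unfolding T_def by auto
  qed
  have "(\<Sum>i<?m. s i - arr \<sigma> i) \<le> (\<Sum>i<?m. r (loc \<sigma> i) + excess (arr \<sigma>) (loc \<sigma>) (?B i) (?b i) i ?m)
      + (\<Sum>i<?m. max 0 (s i - T))"
    unfolding sum.distrib[symmetric] by (intro sum_mono) (use wait in auto)
  also have "(\<Sum>i<?m. max 0 (s i - T)) \<le> real (card X) * D"
    by (rule greedy_wait_after_last_arrival[OF metric G X T D])
  finally show ?thesis using greedy_cost_le_wait[OF G] by simp
qed

text \<open>Two matched requests share a matching time that is no earlier than either arrival, so
  together they wait at least the difference of their arrival times. Hence the cost of a pair is at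
  least their space-time distance, which bounds \<open>g\<close> at both ends; counting it for both
  ends gives the factor 2.\<close>

lemma OPT_ge_nearest:
  assumes even: "even (length \<sigma>)" and sym: "\<And>x y. d x y = d y x"
    and g: "\<And>i j. i < length \<sigma> \<Longrightarrow> j < length \<sigma> \<Longrightarrow> i \<noteq> j \<Longrightarrow>
              g i \<le> d (loc \<sigma> i) (loc \<sigma> j) + \<bar>arr \<sigma> i - arr \<sigma> j\<bar>"
  shows "(\<Sum>i<length \<sigma>. g i) \<le> 2 * OPT d \<sigma>"
proof -
  obtain M s where sol: "mpmd_solution \<sigma> (M, s)" and opt: "OPT d \<sigma> = mpmd_cost d \<sigma> (M, s)"
    using OPT_attained[OF even, of d] by auto
  have M: "perfect_matching_on {..<length \<sigma>} M"
    and ge: "\<And>j. j < length \<sigma> \<Longrightarrow> arr \<sigma> j \<le> s j" and eq: "\<And>a b. (a, b) \<in> M \<Longrightarrow> s a = s b"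
    using sol by (auto simp: mpmd_solution_def)
  have "(\<Sum>i<length \<sigma>. g i) = (\<Sum>(i, j)\<in>M. g i + g j)"
    by (rule sum_perfect_matching[OF M]) simp
  also have "\<dots> \<le> (\<Sum>(i, j)\<in>M. 2 * (d (loc \<sigma> i) (loc \<sigma> j) + ((s i - arr \<sigma> i) + (s j - arr \<sigma> j))))"
  proof (intro sum_mono, clarify)
    fix i j assume ij: "(i, j) \<in> M"
    then have *: "i < length \<sigma>" "j < length \<sigma>" "i \<noteq> j"
      using M by (auto simp: perfect_matching_on_def)
    have abs: "\<bar>arr \<sigma> i - arr \<sigma> j\<bar> \<le> (s i - arr \<sigma> i) + (s j - arr \<sigma> j)"
      using ge[OF *(1)] ge[OF *(2)] eq[OF ij] by auto
    have "g i + g j \<le> 2 * (d (loc \<sigma> i) (loc \<sigma> j) + \<bar>arr \<sigma> i - arr \<sigma> j\<bar>)"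
      using g[OF *] g[OF *(2,1) *(3)[symmetric]]
      by (simp add: sym[of "loc \<sigma> j"] abs_minus_commute[of "arr \<sigma> j"])
    also have "\<dots> \<le> 2 * (d (loc \<sigma> i) (loc \<sigma> j) + ((s i - arr \<sigma> i) + (s j - arr \<sigma> j)))"
      using abs by simp
    finally show "g i + g j \<le> 2 * (d (loc \<sigma> i) (loc \<sigma> j) + ((s i - arr \<sigma> i) + (s j - arr \<sigma> j)))" .
  qed
  also have "\<dots> = 2 * ((\<Sum>(i, j)\<in>M. d (loc \<sigma> i) (loc \<sigma> j)) +
      (\<Sum>(i, j)\<in>M. (s i - arr \<sigma> i) + (s j - arr \<sigma> j)))"
    by (simp add: sum_distrib_left split_def flip: sum.distrib)
  also have "(\<Sum>(i, j)\<in>M. (s i - arr \<sigma> i) + (s j - arr \<sigma> j)) = (\<Sum>i<length \<sigma>. s i - arr \<sigma> i)"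
    by (rule sum_perfect_matching[OF M, symmetric]) simp
  finally show ?thesis by (simp add: opt mpmd_cost_def)
qed

text \<open>The product of a radius and the rate of its ball increases but jumps at each distance
  from \<open>x\<close>, so it may skip the value 1. At the crossing only the closed ball is
  guaranteed a product of at least 1, and only the open ball a product of at most 1.\<close>

lemma critical_radius_exists:
  assumes "Metric_space X d" "finite X" "x \<in> X" and pos: "\<And>y. y \<in> X \<Longrightarrow> 0 < rate y"
  shows "\<exists>r>0. 1 \<le> r * (\<Sum>y\<in>{y\<in>X. d x y \<le> r}. rate y) \<and> r * (\<Sum>y\<in>{y\<in>X. d x y < r}. rate y) \<le> (1::real)"
proof -
  interpret Metric_space X d by fact
  define L where "L r = (\<Sum>y\<in>{y\<in>X. d x y \<le> r}. rate y)" for r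
  have L_mono: "L a \<le> L b" if "a \<le> b" for a b
    unfolding L_def using that \<open>finite X\<close> pos by (intro sum_mono2) (auto intro: less_imp_le)
  have L_pos: "0 < L a" if "0 \<le> a" for a
    unfolding L_def using that \<open>finite X\<close> pos \<open>x \<in> X\<close> by (intro sum_pos) auto
  \<comment> \<open>For a ball frozen at the distance \<open>a\<close>, the candidate is the first
    radius from \<open>a\<close> on whose product with \<open>L a\<close> reaches 1. The smallest
    candidate is the crossing point.\<close>
  define R where "R = (\<lambda>a. max a (1 / L a)) ` d x ` X"
  define r where "r = Min R"
  have R: "finite R" "R \<noteq> {}" using \<open>finite X\<close> \<open>x \<in> X\<close> by (auto simp: R_def)
  then have "r \<in> R" unfolding r_def by (rule Min_in)
  then obtain a where a: "0 \<le> a" "r = max a (1 / L a)"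
    unfolding R_def using nonneg by blast
  have r0: "0 < r" using a L_pos[OF a(1)] by (simp add: less_max_iff_disj)
  have "1 = 1 / L a * L a" using L_pos[OF a(1)] by simp
  also have "\<dots> \<le> r * L r"
    using a r0 L_mono[of a r] L_pos[OF a(1)] by (intro mult_mono) auto
  finally have lower: "1 \<le> r * L r" .
  \<comment> \<open>The largest distance below \<open>r\<close>: the open ball of radius
    \<open>r\<close> is the closed ball of radius \<open>b\<close>. Since \<open>b < r\<close> while
    the candidate belonging to \<open>b\<close> is at least \<open>r\<close>, that candidate must be
    \<open>1 / L b\<close>, which gives the upper bound.\<close>
  define b where "b = Max (d x ` {y\<in>X. d x y < r})"
  have "x \<in> {y\<in>X. d x y < r}" using r0 \<open>x \<in> X\<close> by simp
  then have fin: "finite (d x ` {y\<in>X. d x y < r})" and ne: "d x ` {y\<in>X. d x y < r} \<noteq> {}"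
    using \<open>finite X\<close> by auto
  have b_in: "b \<in> d x ` {y\<in>X. d x y < r}" unfolding b_def by (rule Max_in[OF fin ne])
  then have b: "0 \<le> b" "b < r" "b \<in> d x ` X" by auto
  have ball: "{y\<in>X. d x y < r} = {y\<in>X. d x y \<le> b}"
    using b Max_ge[OF fin] by (auto simp: b_def)
  have "max b (1 / L b) \<in> R" using b(3) by (auto simp: R_def)
  then have "r \<le> max b (1 / L b)" unfolding r_def using R by simp
  then have "r \<le> 1 / L b" using b by auto
  then have "r * L b \<le> 1" using L_pos[OF b(1)] by (simp add: field_simps)
  then have "r * (\<Sum>y\<in>{y\<in>X. d x y < r}. rate y) \<le> 1" by (simp add: ball L_def)
  with lower r0 show ?thesis by (intro exI[of _ r]) (simp add: L_def)
qed

section \<open>Integrals of the exponential distribution\<close>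

abbreviation exp_law :: "real \<Rightarrow> real measure" where
  "exp_law l \<equiv> density lborel (\<lambda>w. ennreal (exponential_density l w))"

lemma AE_exp_law_pos: "AE w in exp_law l. 0 < w"
proof -
  have "AE w in lborel. w \<noteq> (0::real)" by (rule AE_lborel_singleton)
  then have "AE w in lborel. 0 < ennreal (exponential_density l w) \<longrightarrow> 0 < w"
    by (rule AE_mp) (auto simp: exponential_density_def intro!: AE_I2)
  then show ?thesis by (subst AE_density) auto
qed

lemma nn_integral_exp_law_gt:
  assumes l: "0 < l" and a: "0 \<le> a"
  shows "(\<integral>\<^sup>+ w. indicator {a<..} w \<partial>exp_law l) = ennreal (exp (- a * l))"
proof -
  have "(\<integral>\<^sup>+ w. indicator {a<..} w \<partial>exp_law l) =
      (\<integral>\<^sup>+ w. ennreal (exponential_density l w) * indicator {a<..} w \<partial>lborel)"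
    by (subst nn_integral_density) auto
  also have "\<dots> = (\<integral>\<^sup>+ w. ennreal (l * exp (- w * l)) * indicator {a..} w \<partial>lborel)"
    using AE_lborel_singleton[of a] a
    by (intro nn_integral_cong_AE) (auto simp: exponential_density_def indicator_def)
  also have "\<dots> = ennreal (0 - - exp (- a * l))"
  proof (rule nn_integral_FTC_atLeast)
    show "((\<lambda>w. - exp (- w * l)) has_real_derivative l * exp (- w * l)) (at w)" for w
      by (auto intro!: derivative_eq_intros)
    have "((\<lambda>w. - exp (- (l * w))) \<longlongrightarrow> - 0) at_top"
      by (intro tendsto_minus filterlim_compose[OF exp_at_bot]
          filterlim_compose[OF filterlim_uminus_at_bot_at_top]
          filterlim_tendsto_pos_mult_at_top[OF tendsto_const l filterlim_ident])
    then show "((\<lambda>w. - exp (- w * l)) \<longlongrightarrow> 0) at_top" by (simp add: mult.commute)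
  qed (use l in auto)
  finally show ?thesis by simp
qed

text \<open>Memorylessness: the waiting time exceeds \<open>a\<close> with probability
  \<open>exp (- a * l)\<close>, and the overshoot then has mean \<open>1 / l\<close> again.\<close>

lemma nn_integral_exp_law_excess:
  assumes l: "0 < l" and a: "0 \<le> a"
  shows "(\<integral>\<^sup>+ w. ennreal (max 0 (w - a)) \<partial>exp_law l) = ennreal (exp (- a * l) / l)"
proof -
  let ?F = "\<lambda>w. - (w - a + 1 / l) * exp (- w * l)"
  have "(\<integral>\<^sup>+ w. ennreal (max 0 (w - a)) \<partial>exp_law l) =
      (\<integral>\<^sup>+ w. ennreal (exponential_density l w) * ennreal (max 0 (w - a)) \<partial>lborel)"
    by (subst nn_integral_density) auto
  also have "\<dots> = (\<integral>\<^sup>+ w. ennreal (l * exp (- w * l) * (w - a)) * indicator {a..} w \<partial>lborel)"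
    using a l by (intro nn_integral_cong)
      (auto simp: exponential_density_def indicator_def max_def ennreal_mult')
  also have "\<dots> = ennreal (0 - ?F a)"
  proof (rule nn_integral_FTC_atLeast[where F = ?F])
    show "(?F has_real_derivative l * exp (- w * l) * (w - a)) (at w)" for w
      using l by (auto intro!: derivative_eq_intros simp: field_simps)
    show "(?F \<longlongrightarrow> 0) at_top" using l by real_asymp
  qed (use l in auto)
  finally show ?thesis by simp
qed

text \<open>One step of the supermartingale that bounds the excess: when the process enters the time after
  \<open>a\<close>, the gain \<open>1 / l\<close> is paid for by the probability \<open>q\<close> of losing \<open>\<rho>\<close>.\<close>

lemma exp_law_drift:
  assumes l: "0 < l" and a: "0 \<le> a" and q: "0 \<le> q" "q \<le> 1" and \<rho>: "0 \<le> \<rho>" "1 \<le> \<rho> * (q * l)" and c: "0 \<le> c"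
  shows "(\<integral>\<^sup>+ w. ennreal (c + max 0 (w - a) + (if a < w then \<rho> * (1 - q) else \<rho>)) \<partial>exp_law l)
     \<le> ennreal (c + \<rho>)"
proof -
  interpret prob_space "exp_law l" by (rule prob_space_exponential_density[OF l])
  let ?I = "\<integral>\<^sup>+ w. ennreal (c + max 0 (w - a) + (if a < w then \<rho> * (1 - q) else \<rho>)) \<partial>exp_law l"
  let ?e = "exp (- a * l)"
  \<comment> \<open>The expected loss is added on the left instead of being subtracted on the right,
    so that all integrands stay nonnegative; it is finite and cancels at the end.\<close>
  have "?I + ennreal (\<rho> * q * ?e) =
      ?I + (\<integral>\<^sup>+ w. ennreal (\<rho> * q) * indicator {a<..} w \<partial>exp_law l)"
    using \<rho> q by (subst nn_integral_cmult)
      (auto simp: nn_integral_exp_law_gt[OF l a, simplified] ennreal_mult')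
  also have "\<dots> = (\<integral>\<^sup>+ w. ennreal (c + max 0 (w - a) + (if a < w then \<rho> * (1 - q) else \<rho>))
      + ennreal (\<rho> * q) * indicator {a<..} w \<partial>exp_law l)"
    by (subst nn_integral_add) auto
  also have "\<dots> = (\<integral>\<^sup>+ w. ennreal (c + \<rho>) + ennreal (max 0 (w - a)) \<partial>exp_law l)"
  proof (intro nn_integral_cong)
    fix w
    have "0 \<le> \<rho> * (1 - q)" "0 \<le> \<rho> * q" using \<rho> q by auto
    then show "ennreal (c + max 0 (w - a) + (if a < w then \<rho> * (1 - q) else \<rho>))
        + ennreal (\<rho> * q) * indicator {a<..} w = ennreal (c + \<rho>) + ennreal (max 0 (w - a))"
      using \<rho> c by (auto simp: indicator_def max_def algebra_simps simp flip: ennreal_plus)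
  qed
  also have "\<dots> = ennreal (c + \<rho>) + ennreal (?e / l)"
    using emeasure_space_1
    by (subst nn_integral_add) (auto simp: nn_integral_exp_law_excess[OF l a, simplified])
  also have "?e / l \<le> \<rho> * q * ?e"
  proof -
    have "?e * 1 \<le> ?e * (\<rho> * (q * l))" using \<rho> by (intro mult_left_mono) auto
    then show ?thesis using l by (simp add: field_simps)
  qed
  finally have "?I + ennreal (\<rho> * q * ?e) \<le> ennreal (c + \<rho>) + ennreal (\<rho> * q * ?e)"
    by (simp add: add_left_mono ennreal_leI)
  then show ?thesis by (simp add: add.commute[of _ "ennreal (\<rho> * q * ?e)"] ennreal_add_left_cancel_le)
qed

text \<open>Thinning: the first event of a Poisson process of rate \<open>l\<close> that survives an independent
  selection with probability \<open>q\<close> has rate \<open>q * l\<close>; here conditioned on the first step.\<close>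

lemma exp_law_renewal:
  assumes l: "0 < l" and q: "0 \<le> q" "q \<le> 1" and c: "0 \<le> c"
    and g: "\<And>v. 0 \<le> v \<Longrightarrow> ennreal (c * ((1 - q) * exp (- (q * l * v)))) \<le> g v"
    and g_neg: "\<And>v. v < 0 \<Longrightarrow> ennreal c \<le> g v"
  shows "ennreal (c * exp (- (q * l * max 0 u))) \<le> (\<integral>\<^sup>+ w. g (u - w) \<partial>exp_law l)"
proof (cases "u < 0")
  case True
  interpret prob_space "exp_law l" by (rule prob_space_exponential_density[OF l])
  have "ennreal c = (\<integral>\<^sup>+ w. ennreal c \<partial>exp_law l)" using emeasure_space_1 by simp
  also have "\<dots> \<le> (\<integral>\<^sup>+ w. g (u - w) \<partial>exp_law l)"
    using AE_exp_law_pos by (intro nn_integral_mono_AE, rule AE_mp) (use True g_neg in \<open>auto intro!: AE_I2\<close>)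
  finally show ?thesis using True by simp
next
  case False
  then have u: "0 \<le> u" by simp
  \<comment> \<open>An event at time \<open>w\<close> within the window contributes the density of
    \<open>w\<close> times the bound for the remaining time \<open>u - w\<close>; the two
    exponentials merge into \<open>exp (- (q * l * u)) * exp (- ((1 - q) * l * w))\<close>, which
    integrates explicitly.\<close>
  let ?F = "\<lambda>w. - (c * exp (- (q * l * u)) * exp (- ((1 - q) * l * w)))"
  let ?f = "\<lambda>w. c * (1 - q) * l * exp (- (q * l * u)) * exp (- ((1 - q) * l * w))"
  have "(\<integral>\<^sup>+ w. ennreal (c * ((1 - q) * exp (- (q * l * (u - w))))) * indicator {0..u} w \<partial>exp_law l)
      = (\<integral>\<^sup>+ w. ennreal (exponential_density l w) *
          (ennreal (c * ((1 - q) * exp (- (q * l * (u - w))))) * indicator {0..u} w) \<partial>lborel)"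
    by (subst nn_integral_density) auto
  also have "\<dots> = (\<integral>\<^sup>+ w. ennreal (?f w) * indicator {0..u} w \<partial>lborel)"
  proof (intro nn_integral_cong)
    fix w
    have "l * exp (- w * l) * (c * ((1 - q) * exp (- (q * l * (u - w))))) = ?f w"
      by (simp add: mult_exp_exp algebra_simps)
    then show "ennreal (exponential_density l w) *
        (ennreal (c * ((1 - q) * exp (- (q * l * (u - w))))) * indicator {0..u} w) =
        ennreal (?f w) * indicator {0..u} w"
      using l q c by (auto simp: exponential_density_def indicator_def simp flip: ennreal_mult)
  qed
  also have "\<dots> = ennreal (?F u - ?F 0)"
    using l q c u by (intro nn_integral_FTC_Icc)
      (auto intro!: derivative_eq_intros simp: has_real_derivative_iff_has_vector_derivative[symmetric])
  also have "?F u - ?F 0 = c * exp (- (q * l * u)) - c * exp (- u * l)"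
    by (simp add: mult_exp_exp algebra_simps)
  finally have 1: "(\<integral>\<^sup>+ w. ennreal (c * ((1 - q) * exp (- (q * l * (u - w))))) * indicator {0..u} w \<partial>exp_law l)
      = ennreal (c * exp (- (q * l * u)) - c * exp (- u * l))" .
  have 2: "(\<integral>\<^sup>+ w. ennreal c * indicator {u<..} w \<partial>exp_law l) = ennreal (c * exp (- u * l))"
    using c by (subst nn_integral_cmult) (auto simp: nn_integral_exp_law_gt[OF l u, simplified] ennreal_mult')
  have le: "c * exp (- u * l) \<le> c * exp (- (q * l * u))"
    using c q l u by (intro mult_left_mono) (auto simp: mult_left_le_one_le mult.commute mult.left_commute mult.assoc)
  \<comment> \<open>The cases of a first event inside and beyond the window add up exactly: the
    boundary term lost in the first is the mass \<open>c * exp (- u * l)\<close> of the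
    second.\<close>
  have "ennreal (c * exp (- (q * l * max 0 u))) =
      ennreal (c * exp (- (q * l * u)) - c * exp (- u * l)) + ennreal (c * exp (- u * l))"
    using c u le by (subst ennreal_plus[symmetric]) auto
  also have "\<dots> = (\<integral>\<^sup>+ w. ennreal (c * ((1 - q) * exp (- (q * l * (u - w))))) * indicator {0..u} w
      + ennreal c * indicator {u<..} w \<partial>exp_law l)"
    unfolding 1[symmetric] 2[symmetric] by (subst nn_integral_add) auto
  also have "\<dots> \<le> (\<integral>\<^sup>+ w. g (u - w) \<partial>exp_law l)"
    using g g_neg by (intro nn_integral_mono) (auto simp: indicator_def)
  finally show ?thesis .
qed

section \<open>The Poisson arrival model\<close>

abbreviation arrival :: "(nat \<Rightarrow> real \<times> 'a) \<Rightarrow> nat \<Rightarrow> real" where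
  "arrival \<omega> k \<equiv> (\<Sum>j\<le>k. fst (\<omega> j))"

lemma arrival_upd_less [simp]: "k < n \<Longrightarrow> arrival (\<omega> (n := z)) k = arrival \<omega> k"
  by (intro sum.cong) auto

lemma waits_upd [simp]: "(\<Sum>j<(n::nat). fst ((\<omega> (n := z)) j)) = (\<Sum>j<n. fst (\<omega> j))"
  by (intro sum.cong) auto

lemma arrival_upd_same [simp]: "arrival (\<omega> (n := z)) n = (\<Sum>j<n. fst (\<omega> j)) + fst z"
  by (simp only: lessThan_Suc_atMost[symmetric] sum.lessThan_Suc waits_upd) simp

lemma arrival_mono:
  assumes "\<And>k. k < n \<Longrightarrow> 0 < fst (\<omega> k)" "k < n"
  shows "arrival \<omega> k \<le> (\<Sum>j<n. fst (\<omega> j))"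
  using assms by (intro sum_mono2) (auto intro: less_imp_le)

lemma borel_measurable_pred_le [measurable (raw)]:
  fixes f g :: "'b \<Rightarrow> real"
  shows "f \<in> borel_measurable M \<Longrightarrow> g \<in> borel_measurable M \<Longrightarrow> Measurable.pred M (\<lambda>w. f w \<le> g w)"
  unfolding pred_def by (rule borel_measurable_le)

locale poisson_model = Metric_space X d for X :: "'a set" and d +
  fixes rate :: "'a \<Rightarrow> real"
  assumes finite_X: "finite X" and X_nonempty: "X \<noteq> {}"
    and rate_pos: "\<And>x. x \<in> X \<Longrightarrow> 0 < rate x"
begin

abbreviation total :: real where "total \<equiv> \<Sum>x\<in>X. rate x"

definition pr :: "'a \<Rightarrow> real" where "pr x = rate x / total"

abbreviation P :: "nat \<Rightarrow> (nat \<Rightarrow> real \<times> 'a) measure" where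
  "P \<equiv> poisson_arrivals X rate"

abbreviation step :: "(real \<times> 'a) measure" where
  "step \<equiv> exp_law total \<Otimes>\<^sub>M point_measure X (\<lambda>x. ennreal (pr x))"

lemma total_pos: "0 < total"
  using finite_X X_nonempty rate_pos by (simp add: sum_pos)

lemma pr_nonneg: "x \<in> X \<Longrightarrow> 0 \<le> pr x"
  using rate_pos total_pos by (simp add: pr_def less_imp_le)

lemma sum_pr: "(\<Sum>x\<in>X. pr x) = 1"
  using total_pos by (simp add: pr_def flip: sum_divide_distrib)

lemma sum_pr_const: "(\<Sum>y\<in>X. ennreal (pr y) * c) = c"
proof -
  have "(\<Sum>y\<in>X. ennreal (pr y) * c) = ennreal (\<Sum>y\<in>X. pr y) * c"
    using pr_nonneg by (simp add: sum_distrib_right[symmetric] sum_ennreal)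
  then show ?thesis by (simp add: sum_pr)
qed

lemma prob_exp: "prob_space (exp_law total)"
  by (rule prob_space_exponential_density[OF total_pos])

lemma prob_loc: "prob_space (point_measure X (\<lambda>x. ennreal (pr x)))"
  using finite_X sum_pr pr_nonneg by (intro prob_space_point_measure) auto

lemma prob_step: "prob_space step"
  by (rule prob_space_pair[OF prob_exp prob_loc])

lemma prob_P: "prob_space (P n)"
  by (rule prob_space_poisson_arrivals[OF finite_X X_nonempty rate_pos])

lemma P_altdef: "P n = Pi\<^sub>M {..<n} (\<lambda>_. step)"
  by (simp add: poisson_arrivals_def pr_def)

lemma product_step: "product_sigma_finite (\<lambda>_::nat. step)"
  using prob_step by (simp add: product_sigma_finite_def prob_space_imp_sigma_finite)

lemma space_P: "\<omega> \<in> space (P n) \<Longrightarrow> k < n \<Longrightarrow> snd (\<omega> k) \<in> X"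
  by (auto simp: P_altdef space_PiM space_pair_measure space_point_measure PiE_def Pi_def mem_Times_iff)

lemma nn_integral_step:
  assumes "f \<in> borel_measurable step"
  shows "(\<integral>\<^sup>+ z. f z \<partial>step) = (\<integral>\<^sup>+ w. (\<Sum>y\<in>X. ennreal (pr y) * f (w, y)) \<partial>exp_law total)"
proof -
  interpret loc: prob_space "point_measure X (\<lambda>x. ennreal (pr x))" by (rule prob_loc)
  show ?thesis
    by (subst loc.nn_integral_fst[OF assms, symmetric])
      (simp add: nn_integral_point_measure_finite[OF finite_X])
qed

lemma nn_integral_P_Suc:
  assumes f: "f \<in> borel_measurable (P (Suc n))"
  shows "(\<integral>\<^sup>+ \<omega>. f \<omega> \<partial>P (Suc n)) =
     (\<integral>\<^sup>+ \<omega>. (\<integral>\<^sup>+ w. (\<Sum>y\<in>X. ennreal (pr y) * f (\<omega> (n := (w, y)))) \<partial>exp_law total) \<partial>P n)"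
proof -
  interpret product_sigma_finite "\<lambda>_::nat. step" by (rule product_step)
  have [measurable]: "f \<in> borel_measurable (Pi\<^sub>M (insert n {..<n}) (\<lambda>_. step))"
    using f by (simp add: P_altdef lessThan_Suc)
  have "(\<integral>\<^sup>+ \<omega>. f \<omega> \<partial>P (Suc n)) = (\<integral>\<^sup>+ \<omega>. (\<integral>\<^sup>+ z. f (\<omega> (n := z)) \<partial>step) \<partial>P n)"
    unfolding P_altdef lessThan_Suc by (rule product_nn_integral_insert) auto
  also have "\<dots> = (\<integral>\<^sup>+ \<omega>. (\<integral>\<^sup>+ w. (\<Sum>y\<in>X. ennreal (pr y) * f (\<omega> (n := (w, y)))) \<partial>exp_law total) \<partial>P n)"
  proof (intro nn_integral_cong nn_integral_step)
    fix \<omega> assume "\<omega> \<in> space (P n)"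
    then have [measurable]: "\<omega> \<in> space (Pi\<^sub>M {..<n} (\<lambda>_. step))" by (simp add: P_altdef)
    show "(\<lambda>z. f (\<omega> (n := z))) \<in> borel_measurable step" by measurable
  qed
  finally show ?thesis .
qed

text \<open>With the last arrival integrated outermost, the inner integral is a probability about
  the first \<open>n\<close> arrivals alone, with a window shortened by \<open>w\<close>. An
  induction that is uniform in the window length can then be applied to it.\<close>

lemma nn_integral_P_Suc_rev:
  assumes f: "f \<in> borel_measurable (P (Suc n))"
  shows "(\<integral>\<^sup>+ \<omega>. f \<omega> \<partial>P (Suc n)) =
     (\<integral>\<^sup>+ w. (\<Sum>y\<in>X. ennreal (pr y) * (\<integral>\<^sup>+ \<omega>. f (\<omega> (n := (w, y))) \<partial>P n)) \<partial>exp_law total)"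
proof -
  interpret product_sigma_finite "\<lambda>_::nat. step" by (rule product_step)
  interpret Pn: prob_space "Pi\<^sub>M {..<n} (\<lambda>_. step)" using prob_P[of n] by (simp add: P_altdef)
  have [measurable]: "f \<in> borel_measurable (Pi\<^sub>M (insert n {..<n}) (\<lambda>_. step))"
    using f by (simp add: P_altdef lessThan_Suc)
  have "(\<integral>\<^sup>+ \<omega>. f \<omega> \<partial>P (Suc n)) = (\<integral>\<^sup>+ z. (\<integral>\<^sup>+ \<omega>. f (\<omega> (n := z)) \<partial>P n) \<partial>step)"
    unfolding P_altdef lessThan_Suc by (rule product_nn_integral_insert_rev) auto
  also have "\<dots> = (\<integral>\<^sup>+ w. (\<Sum>y\<in>X. ennreal (pr y) * (\<integral>\<^sup>+ \<omega>. f (\<omega> (n := (w, y))) \<partial>P n)) \<partial>exp_law total)"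
    unfolding P_altdef by (rule nn_integral_step) measurable
  finally show ?thesis .
qed

section \<open>Measurability of waiting times and locations\<close>

lemma measurable_wait [measurable (raw)]: "(\<lambda>\<omega>. fst (\<omega> k)) \<in> borel_measurable (P n)"
proof (cases "k < n")
  case True
  have "(\<lambda>\<omega>. \<omega> k) \<in> Pi\<^sub>M {..<n} (\<lambda>_. step) \<rightarrow>\<^sub>M step"
    using True by (intro measurable_component_singleton) auto
  then have "(\<lambda>\<omega>. fst (\<omega> k)) \<in> Pi\<^sub>M {..<n} (\<lambda>_. step) \<rightarrow>\<^sub>M exp_law total"
    by (rule measurable_compose) (rule measurable_fst)
  then show ?thesis by (simp add: P_altdef)
next
  case False
  \<comment> \<open>Coordinates outside the index set are \<open>undefined\<close> throughout the
    product space, so the map is constant there and no bound on \<open>k\<close> has to be carried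
    along.\<close>
  then have "fst (\<omega> k) = fst (undefined :: real \<times> 'a)" if "\<omega> \<in> space (P n)" for \<omega>
    using that by (auto simp: P_altdef space_PiM PiE_def extensional_def)
  then show ?thesis by (subst measurable_cong[where g = "\<lambda>_. fst (undefined :: real \<times> 'a)"]) auto
qed

text \<open>The type of locations carries no sigma-algebra, so the target is a finite discrete
  space, which makes every function of a location measurable. The additional point is the value at
  indices outside the product.\<close>

lemma measurable_loc:
  "(\<lambda>\<omega>. snd (\<omega> k)) \<in> P n \<rightarrow>\<^sub>M count_space (insert (snd (undefined :: real \<times> 'a)) X)"
proof (cases "k < n")
  case True
  have "(\<lambda>\<omega>. \<omega> k) \<in> Pi\<^sub>M {..<n} (\<lambda>_. step) \<rightarrow>\<^sub>M step"
    using True by (intro measurable_component_singleton) auto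
  then have "(\<lambda>\<omega>. snd (\<omega> k)) \<in> Pi\<^sub>M {..<n} (\<lambda>_. step) \<rightarrow>\<^sub>M point_measure X (\<lambda>x. ennreal (pr x))"
    by (rule measurable_compose) (rule measurable_snd)
  then show ?thesis
    unfolding P_altdef
    by (rule measurable_compose) (auto simp: measurable_def space_point_measure sets_point_measure)
next
  case False
  then have "snd (\<omega> k) = snd (undefined :: real \<times> 'a)" if "\<omega> \<in> space (P n)" for \<omega>
    using that by (auto simp: P_altdef space_PiM PiE_def extensional_def)
  then show ?thesis by (subst measurable_cong[where g = "\<lambda>_. snd (undefined :: real \<times> 'a)"]) auto
qed

lemma measurable_loc1: "(\<lambda>\<omega>. g (snd (\<omega> k))) \<in> P n \<rightarrow>\<^sub>M count_space UNIV"
  using measurable_loc by (rule measurable_compose) auto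

lemma measurable_loc2: "(\<lambda>\<omega>. g (snd (\<omega> i)) (snd (\<omega> k))) \<in> P n \<rightarrow>\<^sub>M count_space UNIV"
proof -
  let ?Y = "insert (snd (undefined :: real \<times> 'a)) X"
  have "(\<lambda>\<omega>. (snd (\<omega> i), snd (\<omega> k))) \<in> P n \<rightarrow>\<^sub>M count_space ?Y \<Otimes>\<^sub>M count_space ?Y"
    by (intro measurable_Pair measurable_loc)
  also have "count_space ?Y \<Otimes>\<^sub>M count_space ?Y = count_space (?Y \<times> ?Y)"
    using finite_X by (intro pair_measure_countable) (auto intro: countable_finite)
  finally have "(\<lambda>\<omega>. case_prod g (snd (\<omega> i), snd (\<omega> k))) \<in> P n \<rightarrow>\<^sub>M count_space UNIV"
    by (rule measurable_compose) auto
  then show ?thesis by simp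
qed

lemma measurable_loc_borel: "(\<lambda>\<omega>. (g (snd (\<omega> k)) :: real)) \<in> borel_measurable (P n)"
  using measurable_loc1 by (rule measurable_compose) auto

lemma measurable_loc_mem [measurable (raw)]: "Measurable.pred (P n) (\<lambda>\<omega>. snd (\<omega> k) \<in> B)"
  by (rule measurable_loc1)

lemma measurable_loc_eq [measurable (raw)]: "Measurable.pred (P n) (\<lambda>\<omega>. snd (\<omega> k) = x)"
  by (rule measurable_loc1)

lemma AE_wait_pos: "AE \<omega> in P n. \<forall>k<n. 0 < fst (\<omega> k)"
proof -
  have 1: "AE z in step. 0 < fst z"
  proof -
    have *: "distr step (exp_law total) fst = exp_law total"
      by (rule prob_space.distr_pair_fst[OF prob_loc])
    have "AE w in distr step (exp_law total) fst. 0 < w"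
      unfolding * by (rule AE_exp_law_pos)
    then show ?thesis by (subst (asm) AE_distr_iff) auto
  qed
  have "AE \<omega> in P n. 0 < fst (\<omega> k)" if "k < n" for k
    unfolding P_altdef using prob_step 1 that
    by (intro AE_PiM_component[where P = "\<lambda>z. 0 < fst z"]) auto
  then have "AE \<omega> in P n. \<forall>k\<in>{..<n}. 0 < fst (\<omega> k)"
    by (subst AE_finite_all) auto
  then show ?thesis by (rule AE_mp) (auto intro!: AE_I2)
qed

end

section \<open>Expected waiting time of Greedy\<close>

text \<open>With \<open>excess_cong\<close>, this shows that revealing arrival \<open>n\<close> does
  not alter what was determined by the arrivals before it.\<close>

lemma missed_cong:
  assumes "\<And>k. k < n \<Longrightarrow> t k = t' k" "\<And>k. k < n \<Longrightarrow> x k = x' k"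
  shows "missed t x B b i n \<longleftrightarrow> missed t' x' B b i n"
  using assms by (auto simp: missed_def)

lemma excess_cong:
  assumes "\<And>k. k < n \<Longrightarrow> t k = t' k" "\<And>k. k < n \<Longrightarrow> x k = x' k"
  shows "excess t x B b i n = excess t' x' B b i n"
  unfolding excess_def
proof (intro sum.cong refl)
  fix k assume k: "k \<in> {i<..<n}"
  have "missed t x B b i k \<longleftrightarrow> missed t' x' B b i k"
    using k assms by (intro missed_cong) auto
  then show "(if missed t x B b i k then max 0 (t k - max (t (k - 1)) b) else 0) =
      (if missed t' x' B b i k then max 0 (t' k - max (t' (k - 1)) b) else 0)"
    using k assms(1)[of k] assms(1)[of "k - 1"] by auto
qed

context poisson_model
begin

definition rho :: "'a \<Rightarrow> real" where
  "rho x = (SOME r. 0 < r \<and> 1 \<le> r * (\<Sum>y\<in>{y\<in>X. d x y \<le> r}. rate y) \<and>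
     r * (\<Sum>y\<in>{y\<in>X. d x y < r}. rate y) \<le> 1)"

text \<open>The closed ball serves the upper bound, where a total rate of at least
  \<open>1 / rho x\<close> is needed. Its open counterpart \<open>inner\<close> serves the lower
  bound: a request at distance \<open>rho x\<close> or more is far enough for every
  \<open>u \<le> rho x\<close>, so only strictly closer ones have to be kept away in time.\<close>

definition near :: "'a \<Rightarrow> 'a set" where "near x = {y\<in>X. d x y \<le> rho x}"

definition inner :: "'a \<Rightarrow> 'a set" where "inner x = {y\<in>X. d x y < rho x}"

lemma
  assumes "x \<in> X"
  shows rho_pos: "0 < rho x"
    and rho_near: "1 \<le> rho x * (\<Sum>y\<in>near x. rate y)"
    and rho_inner: "rho x * (\<Sum>y\<in>inner x. rate y) \<le> 1"
proof -
  have "0 < rho x \<and> 1 \<le> rho x * (\<Sum>y\<in>near x. rate y) \<and> rho x * (\<Sum>y\<in>inner x. rate y) \<le> 1"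
    unfolding near_def inner_def rho_def
    by (rule someI_ex, rule critical_radius_exists[OF Metric_space_axioms finite_X assms rate_pos])
  then show "0 < rho x" "1 \<le> rho x * (\<Sum>y\<in>near x. rate y)" "rho x * (\<Sum>y\<in>inner x. rate y) \<le> 1"
    by auto
qed

lemma near_subset: "near x \<subseteq> X" and inner_subset: "inner x \<subseteq> X"
  by (auto simp: near_def inner_def)

lemma measurable_rho [measurable (raw)]: "(\<lambda>\<omega>. rho (snd (\<omega> k))) \<in> borel_measurable (P n)"
  by (rule measurable_loc_borel)

lemma measurable_near [measurable (raw)]: "Measurable.pred (P n) (\<lambda>\<omega>. snd (\<omega> k) \<in> near (snd (\<omega> i)))"
  by (rule measurable_loc2[where g = "\<lambda>x y. y \<in> near x"])

definition mean_rho :: real where "mean_rho = (\<Sum>x\<in>X. pr x * rho x)"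

lemma mean_rho_pos: "0 < mean_rho"
  unfolding mean_rho_def using finite_X X_nonempty rate_pos total_pos rho_pos
  by (intro sum_pos) (auto simp: pr_def intro!: mult_pos_pos divide_pos_pos)

lemma emeasure_P [simp]: "emeasure (P n) (space (P n)) = 1"
  by (rule prob_space.emeasure_space_1[OF prob_P])

lemma emeasure_exp_total [simp]: "emeasure (exp_law total) UNIV = 1"
  using prob_space.emeasure_space_1[OF prob_exp] by simp

abbreviation missed_at :: "(nat \<Rightarrow> real \<times> 'a) \<Rightarrow> nat \<Rightarrow> nat \<Rightarrow> bool" where
  "missed_at \<omega> i n \<equiv> missed (arrival \<omega>) (\<lambda>k. snd (\<omega> k)) (near (snd (\<omega> i)))
     (arrival \<omega> i + rho (snd (\<omega> i))) i n"

abbreviation excess_at :: "(nat \<Rightarrow> real \<times> 'a) \<Rightarrow> nat \<Rightarrow> nat \<Rightarrow> real" where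
  "excess_at \<omega> i n \<equiv> excess (arrival \<omega>) (\<lambda>k. snd (\<omega> k)) (near (snd (\<omega> i)))
     (arrival \<omega> i + rho (snd (\<omega> i))) i n"

text \<open>The excess accumulated so far plus a bound on its expected future growth: as long as no
  near arrival has occurred after the deadline, such arrivals come at rate at least
  \<open>1 / rho\<close>, so at most \<open>rho\<close> is still to be expected.\<close>

abbreviation wait_potential :: "(nat \<Rightarrow> real \<times> 'a) \<Rightarrow> nat \<Rightarrow> nat \<Rightarrow> real" where
  "wait_potential \<omega> i n \<equiv> excess_at \<omega> i n + (if missed_at \<omega> i n then rho (snd (\<omega> i)) else 0)"

lemma measurable_missed_at [measurable (raw)]: "Measurable.pred (P m) (\<lambda>\<omega>. missed_at \<omega> i n)"
  unfolding missed_def by measurable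

lemma measurable_excess_at [measurable (raw)]: "(\<lambda>\<omega>. excess_at \<omega> i n) \<in> borel_measurable (P m)"
  unfolding excess_def by measurable

lemma nn_integral_rho:
  assumes "i < n"
  shows "(\<integral>\<^sup>+ \<omega>. ennreal (rho (snd (\<omega> i))) \<partial>P n) = ennreal mean_rho"
  using assms
proof (induction n)
  case (Suc n)
  have "(\<integral>\<^sup>+ \<omega>. ennreal (rho (snd (\<omega> i))) \<partial>P (Suc n)) =
      (\<integral>\<^sup>+ \<omega>. (\<integral>\<^sup>+ w. (\<Sum>y\<in>X. ennreal (pr y) * ennreal (rho (snd ((\<omega> (n := (w, y))) i)))) \<partial>exp_law total) \<partial>P n)"
    by (rule nn_integral_P_Suc) measurable
  also have "\<dots> = ennreal mean_rho"
  proof (cases "i = n")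
    case True
    have "(\<Sum>y\<in>X. ennreal (pr y) * ennreal (rho y)) = ennreal mean_rho"
      using pr_nonneg rho_pos unfolding mean_rho_def
      by (subst sum_ennreal[symmetric]) (auto simp: ennreal_mult less_imp_le intro!: mult_nonneg_nonneg sum.cong)
    then show ?thesis using True by simp
  next
    case False
    then show ?thesis using Suc by (simp add: sum_pr_const)
  qed
  finally show ?case .
qed simp

text \<open>The supermartingale property given the first \<open>n\<close> arrivals. Before the first
  hit it is \<open>exp_law_drift\<close>, with \<open>a\<close> the time left until the deadline and
  \<open>q\<close> the probability that the next location is near; after the hit the potential no
  longer changes.\<close>

lemma wait_potential_step:
  assumes "i < n" and \<omega>: "\<omega> \<in> space (P n)"
  shows "(\<integral>\<^sup>+ w. (\<Sum>y\<in>X. ennreal (pr y) * ennreal (wait_potential (\<omega> (n := (w, y))) i (Suc n))) \<partial>exp_law total)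
     \<le> ennreal (wait_potential \<omega> i n)"
proof -
  define x where "x = snd (\<omega> i)"
  define b where "b = arrival \<omega> i + rho x"
  define S where "S = (\<Sum>j<n. fst (\<omega> j))"
  define a where "a = max 0 (b - S)"
  define c where "c = excess_at \<omega> i n"
  define q where "q = (\<Sum>y\<in>near x. pr y)"
  have x: "x \<in> X" unfolding x_def using \<omega> \<open>i < n\<close> by (rule space_P)
  have c: "0 \<le> c" unfolding c_def by (rule excess_nonneg)
  have S: "arrival \<omega> (n - 1) = S"
    using \<open>i < n\<close> by (cases n) (auto simp: S_def lessThan_Suc_atMost)
  have upd: "snd ((\<omega> (n := z)) i) = x" for z
    using \<open>i < n\<close> by (simp add: x_def)
  have b_upd: "arrival (\<omega> (n := z)) i + rho x = b" for z
    using \<open>i < n\<close> by (simp add: b_def)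
  let ?miss = "\<lambda>z. missed (arrival (\<omega> (n := z))) (\<lambda>k. snd ((\<omega> (n := z)) k)) (near x) b i n"
  let ?ex = "\<lambda>z. excess (arrival (\<omega> (n := z))) (\<lambda>k. snd ((\<omega> (n := z)) k)) (near x) b i"
  have miss: "?miss z \<longleftrightarrow> missed_at \<omega> i n" for z
    unfolding x_def[symmetric] b_def[symmetric] by (rule missed_cong) auto
  have ex: "?ex z n = c" for z
    unfolding c_def x_def[symmetric] b_def[symmetric] by (rule excess_cong) auto
  have new: "excess_at (\<omega> (n := (w, y))) i (Suc n) = c + (if missed_at \<omega> i n then max 0 (w - a) else 0)" for w y
  proof -
    have prev: "arrival (\<omega> (n := (w, y))) (n - 1) = S"
      using \<open>i < n\<close> by (subst arrival_upd_less) (auto simp only: S)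
    have "excess_at (\<omega> (n := (w, y))) i (Suc n) = ?ex (w, y) (Suc n)"
      by (simp only: upd b_upd)
    also have "\<dots> = c + (if missed_at \<omega> i n then max 0 (S + w - max S b) else 0)"
      unfolding excess_Suc[OF \<open>i < n\<close>] miss ex prev arrival_upd_same fst_conv S_def ..
    also have "S + w - max S b = w - a" by (simp add: a_def max_def)
    finally show ?thesis .
  qed
  have new_missed: "missed_at (\<omega> (n := (w, y))) i (Suc n) \<longleftrightarrow>
      missed_at \<omega> i n \<and> (y \<in> near x \<longrightarrow> w \<le> b - S)" for w y
    using \<open>i < n\<close> unfolding missed_Suc upd b_upd miss arrival_upd_same S_def[symmetric] by auto
  have potential: "wait_potential (\<omega> (n := (w, y))) i (Suc n) =
      (if missed_at \<omega> i n then c + max 0 (w - a) + (if y \<in> near x \<longrightarrow> w \<le> b - S then rho x else 0) else c)"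
    for w y
    unfolding new new_missed unfolding upd by simp
  show ?thesis
  proof (cases "missed_at \<omega> i n")
    case False
    then show ?thesis
      by (simp only: potential if_False add_0_right sum_pr_const c_def) simp
  next
    case True
    have q0: "0 \<le> q" unfolding q_def using near_subset pr_nonneg by (intro sum_nonneg) auto
    have q1: "q \<le> 1"
      unfolding q_def sum_pr[symmetric] using finite_X near_subset pr_nonneg by (intro sum_mono2) auto
    have qt: "q * total = (\<Sum>y\<in>near x. rate y)"
      using total_pos by (simp add: q_def pr_def sum_divide_distrib[symmetric])
    \<comment> \<open>This is an inequality only because of nonpositive waits: if the deadline has
      passed, then \<open>a = 0\<close>, and some \<open>w \<le> a\<close> may still lie beyond
      \<open>b - S\<close>.\<close>
    have inner_le: "(\<Sum>y\<in>X. ennreal (pr y) * ennreal (wait_potential (\<omega> (n := (w, y))) i (Suc n)))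
        \<le> ennreal (c + max 0 (w - a) + (if a < w then rho x * (1 - q) else rho x))" for w
    proof -
      have "(\<Sum>y\<in>X. ennreal (pr y) * ennreal (wait_potential (\<omega> (n := (w, y))) i (Suc n)))
          \<le> (\<Sum>y\<in>X. ennreal (pr y * (c + max 0 (w - a) + (if a < w then (if y \<in> near x then 0 else rho x) else rho x))))"
      proof (intro sum_mono)
        fix y assume y: "y \<in> X"
        have "wait_potential (\<omega> (n := (w, y))) i (Suc n) \<le>
            c + max 0 (w - a) + (if a < w then (if y \<in> near x then 0 else rho x) else rho x)"
          using True rho_pos[OF x] unfolding potential by (auto simp: a_def)
        then show "ennreal (pr y) * ennreal (wait_potential (\<omega> (n := (w, y))) i (Suc n)) \<le>
            ennreal (pr y * (c + max 0 (w - a) + (if a < w then (if y \<in> near x then 0 else rho x) else rho x)))"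
          using pr_nonneg[OF y] by (subst ennreal_mult') (auto intro!: mult_left_mono ennreal_leI)
      qed
      also have "\<dots> = ennreal (\<Sum>y\<in>X. pr y * (c + max 0 (w - a) + (if a < w then (if y \<in> near x then 0 else rho x) else rho x)))"
        using pr_nonneg c rho_pos[OF x] by (intro sum_ennreal mult_nonneg_nonneg) auto
      also have "(\<Sum>y\<in>X. pr y * (c + max 0 (w - a) + (if a < w then (if y \<in> near x then 0 else rho x) else rho x)))
          = c + max 0 (w - a) + (if a < w then rho x * (1 - q) else rho x)"
      proof (cases "a < w")
        case True
        have "(\<Sum>y\<in>X. pr y * (c + max 0 (w - a) + (if y \<in> near x then 0 else rho x))) =
            (\<Sum>y\<in>X. pr y * (c + max 0 (w - a) + rho x) - (if y \<in> near x then pr y * rho x else 0))"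
          by (intro sum.cong) (auto simp: algebra_simps)
        also have "\<dots> = (c + max 0 (w - a) + rho x) - rho x * q"
          using finite_X near_subset[of x]
          by (simp add: sum_subtractf sum_distrib_right[symmetric] sum_pr q_def sum.inter_restrict[symmetric]
              Int_absorb1 mult.commute)
        finally show ?thesis using True by (simp add: algebra_simps)
      next
        case False
        then show ?thesis by (simp add: sum_distrib_right[symmetric] sum_pr)
      qed
      finally show ?thesis .
    qed
    have "(\<integral>\<^sup>+ w. (\<Sum>y\<in>X. ennreal (pr y) * ennreal (wait_potential (\<omega> (n := (w, y))) i (Suc n))) \<partial>exp_law total)
        \<le> (\<integral>\<^sup>+ w. ennreal (c + max 0 (w - a) + (if a < w then rho x * (1 - q) else rho x)) \<partial>exp_law total)"
      by (intro nn_integral_mono inner_le)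
    also have "\<dots> \<le> ennreal (c + rho x)"
      using total_pos q0 q1 c rho_pos[OF x] rho_near[OF x] unfolding qt[symmetric]
      by (intro exp_law_drift) (auto simp: a_def)
    finally show ?thesis using True by (simp add: c_def x_def)
  qed
qed

text \<open>Just after arrival \<open>i\<close> the excess is 0 and nothing has been missed yet, so
  the potential starts at \<open>rho\<close> of the location of \<open>i\<close>, whose mean is
  \<open>mean_rho\<close>; later steps do not increase its expectation.\<close>

lemma wait_potential_bound:
  assumes "i < n"
  shows "(\<integral>\<^sup>+ \<omega>. ennreal (wait_potential \<omega> i n) \<partial>P n) \<le> ennreal mean_rho"
  using assms
proof (induction n)
  case (Suc n)
  show ?case
  proof (cases "i = n")
    case True
    then show ?thesis using nn_integral_rho[of n "Suc n"] by simp
  next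
    case False
    then have "i < n" using Suc.prems by simp
    have "(\<integral>\<^sup>+ \<omega>. ennreal (wait_potential \<omega> i (Suc n)) \<partial>P (Suc n)) =
       (\<integral>\<^sup>+ \<omega>. (\<integral>\<^sup>+ w. (\<Sum>y\<in>X. ennreal (pr y) *
          ennreal (wait_potential (\<omega> (n := (w, y))) i (Suc n))) \<partial>exp_law total) \<partial>P n)"
      by (rule nn_integral_P_Suc) measurable
    also have "\<dots> \<le> (\<integral>\<^sup>+ \<omega>. ennreal (wait_potential \<omega> i n) \<partial>P n)"
      using \<open>i < n\<close> by (intro nn_integral_mono wait_potential_step)
    also have "\<dots> \<le> ennreal mean_rho" by (rule Suc.IH) fact
    finally show ?thesis .
  qed
qed simp

end

section \<open>Isolation probability\<close>

context poisson_model
begin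

text \<open>The past as seen from the most recent arrival, of index \<open>n - 1\<close>. For
  \<open>v \<ge> 0\<close> that arrival, at time difference 0, must itself lie outside
  \<open>B\<close>; this is the origin of the factor \<open>1 - q\<close> in the lower
  bound.\<close>

definition clear_before :: "'a set \<Rightarrow> nat \<Rightarrow> real \<Rightarrow> (nat \<Rightarrow> real \<times> 'a) \<Rightarrow> bool" where
  "clear_before B n v \<omega> \<longleftrightarrow> (\<forall>k<n. snd (\<omega> k) \<in> B \<longrightarrow> v < (\<Sum>j<n. fst (\<omega> j)) - arrival \<omega> k)"

definition isolated :: "'a set \<Rightarrow> nat \<Rightarrow> nat \<Rightarrow> real \<Rightarrow> (nat \<Rightarrow> real \<times> 'a) \<Rightarrow> bool" where
  "isolated B i n u \<omega> \<longleftrightarrow>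
     (\<forall>k<n. k \<noteq> i \<longrightarrow> snd (\<omega> k) \<in> B \<longrightarrow> u < \<bar>arrival \<omega> k - arrival \<omega> i\<bar>)"

lemma measurable_clear_before [measurable (raw)]: "Measurable.pred (P m) (clear_before B n v)"
  unfolding clear_before_def by measurable

lemma measurable_isolated [measurable (raw)]: "Measurable.pred (P m) (isolated B i n u)"
  unfolding isolated_def by measurable

text \<open>Almost surely all waits are positive, so no earlier arrival lies at a negative time
  difference. This is the case of a first wait that exceeds the whole window in the renewal
  argument.\<close>

lemma clear_before_neg:
  assumes "v < 0"
  shows "(\<integral>\<^sup>+ \<omega>. (if clear_before B n v \<omega> then 1 else 0) \<partial>P n) = 1"
proof -
  have "(\<integral>\<^sup>+ \<omega>. (if clear_before B n v \<omega> then 1 else 0) \<partial>P n) = (\<integral>\<^sup>+ \<omega>. 1 \<partial>P n)"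
  proof (intro nn_integral_cong_AE, rule AE_mp[OF AE_wait_pos], rule AE_I2, rule impI)
    fix \<omega> :: "nat \<Rightarrow> real \<times> 'a" assume pos: "\<forall>k<n. 0 < fst (\<omega> k)"
    have "clear_before B n v \<omega>"
      unfolding clear_before_def using arrival_mono[of n \<omega>] pos assms by fastforce
    then show "(if clear_before B n v \<omega> then 1 else 0) = (1::ennreal)" by simp
  qed
  then show ?thesis by simp
qed

lemma sum_pr_subset:
  assumes "B \<subseteq> X"
  shows "0 \<le> (\<Sum>y\<in>B. pr y)" "(\<Sum>y\<in>B. pr y) \<le> 1"
  using assms finite_X pr_nonneg
  by (auto intro!: sum_nonneg simp flip: sum_pr intro: sum_mono2)

lemma sum_pr_outside:
  assumes "B \<subseteq> X"
  shows "(\<Sum>y\<in>X. ennreal (pr y) * (if y \<in> B then 0 else c)) = ennreal (1 - (\<Sum>y\<in>B. pr y)) * c"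
proof -
  have "(\<Sum>y\<in>X. ennreal (pr y) * (if y \<in> B then 0 else c)) = (\<Sum>y\<in>X - B. ennreal (pr y) * c)"
    using finite_X by (intro sum.mono_neutral_cong_right) auto
  also have "\<dots> = ennreal (\<Sum>y\<in>X - B. pr y) * c"
    using pr_nonneg unfolding sum_distrib_right[symmetric] by (subst sum_ennreal) auto
  also have "(\<Sum>y\<in>X - B. pr y) = 1 - (\<Sum>y\<in>B. pr y)"
    using finite_X assms by (simp add: sum_diff sum_pr finite_subset)
  finally show ?thesis .
qed

text \<open>The newest arrival avoids \<open>B\<close> with probability \<open>1 - q\<close>, and
  the wait before it shortens the window for the remaining ones, so \<open>exp_law_renewal\<close>
  closes the induction. It is only a lower bound because the past is finite: with no arrivals left,
  the window is clear with certainty.\<close>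

lemma clear_before_lower:
  assumes B: "B \<subseteq> X" and "0 \<le> v"
  shows "ennreal ((1 - (\<Sum>y\<in>B. pr y)) * exp (- ((\<Sum>y\<in>B. pr y) * total * v)))
     \<le> (\<integral>\<^sup>+ \<omega>. (if clear_before B n v \<omega> then 1 else 0) \<partial>P n)"
  using \<open>0 \<le> v\<close>
proof (induction n arbitrary: v)
  case 0
  have "(1 - (\<Sum>y\<in>B. pr y)) * exp (- ((\<Sum>y\<in>B. pr y) * total * v)) \<le> 1 * 1"
    using sum_pr_subset[OF B] total_pos 0 by (intro mult_mono) auto
  then show ?case by (simp add: clear_before_def ennreal_le_1)
next
  case (Suc n)
  define q where "q = (\<Sum>y\<in>B. pr y)"
  define h where "h v = (\<integral>\<^sup>+ \<omega>. (if clear_before B n v \<omega> then 1 else 0) \<partial>P n)" for v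
  have q: "0 \<le> q" "q \<le> 1" using sum_pr_subset[OF B] by (auto simp: q_def)
  have upd: "clear_before B (Suc n) v (\<omega> (n := (w, y))) \<longleftrightarrow> y \<notin> B \<and> clear_before B n (v - w) \<omega>" for \<omega> w y
  proof -
    have "(\<Sum>j<Suc n. fst ((\<omega> (n := (w, y))) j)) = (\<Sum>j<n. fst (\<omega> j)) + w"
      by (simp only: sum.lessThan_Suc waits_upd) simp
    moreover have "snd ((\<omega> (n := (w, y))) k) = snd (\<omega> k)" if "k < n" for k
      using that by simp
    moreover have "snd ((\<omega> (n := (w, y))) n) = y" by simp
    ultimately show ?thesis
      using \<open>0 \<le> v\<close> unfolding clear_before_def less_Suc_eq
      by (auto simp del: fun_upd_apply simp: algebra_simps)
  qed
  have "ennreal ((1 - q) * exp (- (q * total * max 0 v))) \<le>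
      (\<integral>\<^sup>+ w. ennreal (1 - q) * h (v - w) \<partial>exp_law total)"
  proof (rule exp_law_renewal[where g = "\<lambda>v. ennreal (1 - q) * h v"])
    show "ennreal ((1 - q) * ((1 - q) * exp (- (q * total * v)))) \<le> ennreal (1 - q) * h v" if "0 \<le> v" for v
      using Suc.IH[OF that] q by (subst ennreal_mult) (auto simp: h_def q_def intro!: mult_left_mono)
    show "ennreal (1 - q) \<le> ennreal (1 - q) * h v" if "v < 0" for v
      using clear_before_neg[OF that] by (simp add: h_def)
  qed (use total_pos q in auto)
  also have "\<dots> = (\<integral>\<^sup>+ w. (\<Sum>y\<in>X. ennreal (pr y) *
      (\<integral>\<^sup>+ \<omega>. (if clear_before B (Suc n) v (\<omega> (n := (w, y))) then 1 else 0) \<partial>P n)) \<partial>exp_law total)"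
  proof (intro nn_integral_cong)
    fix w
    have "(\<integral>\<^sup>+ \<omega>. (if clear_before B (Suc n) v (\<omega> (n := (w, y))) then 1 else 0) \<partial>P n) =
        (if y \<in> B then 0 else h (v - w))" for y
      unfolding upd h_def by simp
    then show "ennreal (1 - q) * h (v - w) = (\<Sum>y\<in>X. ennreal (pr y) *
      (\<integral>\<^sup>+ \<omega>. (if clear_before B (Suc n) v (\<omega> (n := (w, y))) then 1 else 0) \<partial>P n))"
      by (simp only: sum_pr_outside[OF B] q_def)
  qed
  also have "\<dots> = (\<integral>\<^sup>+ \<omega>. (if clear_before B (Suc n) v \<omega> then 1 else 0) \<partial>P (Suc n))"
    by (rule nn_integral_P_Suc_rev[symmetric]) measurable
  finally show ?case using \<open>0 \<le> v\<close> by (simp add: q_def)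
qed

text \<open>On the event that request \<open>i\<close> is at \<open>x\<close> and isolated so far,
  the exponential is the probability that a Poisson stream in \<open>B\<close> stays silent for the
  rest of the window of length \<open>u\<close> after arrival \<open>i\<close>; the subtracted
  difference is the time already elapsed.\<close>

abbreviation gap_potential :: "'a \<Rightarrow> 'a set \<Rightarrow> real \<Rightarrow> nat \<Rightarrow> nat \<Rightarrow> (nat \<Rightarrow> real \<times> 'a) \<Rightarrow> ennreal" where
  "gap_potential x B u i n \<omega> \<equiv> (if snd (\<omega> i) = x \<and> isolated B i n u \<omega> then
     ennreal (exp (- ((\<Sum>y\<in>B. pr y) * total * max 0 (u - ((\<Sum>j<n. fst (\<omega> j)) - arrival \<omega> i))))) else 0)"

text \<open>One factor \<open>exp (- (q * total * u))\<close> is the clear window before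
  \<open>i\<close>, the other is the initial value of the potential for the window after it. Request
  \<open>i\<close> may lie in \<open>B\<close> itself, so no factor \<open>1 - q\<close> is due for
  it; the one due for its predecessor is absorbed by averaging over the wait in between.\<close>

lemma gap_potential_start:
  assumes B: "B \<subseteq> X" and x: "x \<in> X" and u: "0 \<le> u"
  shows "ennreal (pr x * exp (- (2 * ((\<Sum>y\<in>B. pr y) * total * u)))) \<le>
     (\<integral>\<^sup>+ \<omega>. gap_potential x B u i (Suc i) \<omega> \<partial>P (Suc i))"
proof -
  define q where "q = (\<Sum>y\<in>B. pr y)"
  define c where "c = pr x * exp (- (q * total * u))"
  define h where "h v = (\<integral>\<^sup>+ \<omega>. (if clear_before B i v \<omega> then 1 else 0) \<partial>P i)" for v
  have q: "0 \<le> q" "q \<le> 1" using sum_pr_subset[OF B] by (auto simp: q_def)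
  have c: "0 \<le> c" using pr_nonneg[OF x] by (simp add: c_def)
  have upd: "(if clear_before B i (u - w) \<omega> then 1 else 0) * ennreal (exp (- (q * total * u))) \<le>
      gap_potential x B u i (Suc i) (\<omega> (i := (w, x)))" for w \<omega>
  proof -
    have a: "arrival (\<omega> (i := (w, x))) i = (\<Sum>j<i. fst (\<omega> j)) + w" by (simp only: arrival_upd_same fst_conv)
    have "isolated B i (Suc i) u (\<omega> (i := (w, x)))" if cl: "clear_before B i (u - w) \<omega>"
      unfolding isolated_def a
    proof (intro allI impI)
      fix k assume k: "k < Suc i" "k \<noteq> i" "snd ((\<omega> (i := (w, x))) k) \<in> B"
      then have "k < i" "snd (\<omega> k) \<in> B" by auto
      then have "u - w < (\<Sum>j<i. fst (\<omega> j)) - arrival \<omega> k" using cl by (auto simp: clear_before_def)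
      then show "u < \<bar>arrival (\<omega> (i := (w, x))) k - ((\<Sum>j<i. fst (\<omega> j)) + w)\<bar>"
        unfolding arrival_upd_less[OF \<open>k < i\<close>] by linarith
    qed
    moreover have "(\<Sum>j<Suc i. fst ((\<omega> (i := (w, x))) j)) - arrival (\<omega> (i := (w, x))) i = 0"
      by (simp only: lessThan_Suc_atMost)
    moreover have "snd ((\<omega> (i := (w, x))) i) = x" by simp
    ultimately show ?thesis using u by (auto simp only: q_def diff_0_right max.absorb2 if_True mult_1_left mult_zero_left order_refl zero_le split: if_splits)
  qed
  have "ennreal (c * exp (- (q * total * max 0 u))) \<le> (\<integral>\<^sup>+ w. ennreal c * h (u - w) \<partial>exp_law total)"
  proof (rule exp_law_renewal[where g = "\<lambda>v. ennreal c * h v"])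
    show "ennreal (c * ((1 - q) * exp (- (q * total * v)))) \<le> ennreal c * h v" if "0 \<le> v" for v
      using clear_before_lower[OF B that, of i] q c
      by (subst ennreal_mult) (auto simp: h_def q_def intro!: mult_left_mono)
    show "ennreal c \<le> ennreal c * h v" if "v < 0" for v
      using clear_before_neg[OF that] by (simp add: h_def)
  qed (use total_pos q c in auto)
  also have "\<dots> \<le> (\<integral>\<^sup>+ w. (\<Sum>y\<in>X. ennreal (pr y) *
      (\<integral>\<^sup>+ \<omega>. gap_potential x B u i (Suc i) (\<omega> (i := (w, y))) \<partial>P i)) \<partial>exp_law total)"
  proof (intro nn_integral_mono)
    fix w
    define J where "J y = (\<integral>\<^sup>+ \<omega>. gap_potential x B u i (Suc i) (\<omega> (i := (w, y))) \<partial>P i)" for y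
    have "h (u - w) * ennreal (exp (- (q * total * u))) =
        (\<integral>\<^sup>+ \<omega>. (if clear_before B i (u - w) \<omega> then 1 else 0) * ennreal (exp (- (q * total * u))) \<partial>P i)"
      unfolding h_def by (rule nn_integral_multc[symmetric]) measurable
    also have "\<dots> \<le> J x"
      unfolding J_def by (intro nn_integral_mono upd)
    finally have "ennreal (pr x) * (h (u - w) * ennreal (exp (- (q * total * u)))) \<le> ennreal (pr x) * J x"
      by (rule mult_left_mono) simp
    \<comment> \<open>Only the location \<open>x\<close> of request \<open>i\<close> matters;
      dropping the other summands is harmless.\<close>
    also have "\<dots> \<le> (\<Sum>y\<in>X. ennreal (pr y) * J y)"
      using finite_X x by (intro member_le_sum) auto
    finally have "ennreal (pr x) * (h (u - w) * ennreal (exp (- (q * total * u)))) \<le>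
        (\<Sum>y\<in>X. ennreal (pr y) * J y)" .
    moreover have "ennreal c * h (u - w) = ennreal (pr x) * (h (u - w) * ennreal (exp (- (q * total * u))))"
      using pr_nonneg[OF x] by (simp add: c_def ennreal_mult mult_ac)
    ultimately show "ennreal c * h (u - w) \<le> (\<Sum>y\<in>X. ennreal (pr y) *
        (\<integral>\<^sup>+ \<omega>. gap_potential x B u i (Suc i) (\<omega> (i := (w, y))) \<partial>P i))"
      by (simp only: J_def)
  qed
  also have "\<dots> = (\<integral>\<^sup>+ \<omega>. gap_potential x B u i (Suc i) \<omega> \<partial>P (Suc i))"
    by (rule nn_integral_P_Suc_rev[symmetric]) measurable
  finally have main: "ennreal (c * exp (- (q * total * max 0 u))) \<le>
      (\<integral>\<^sup>+ \<omega>. gap_potential x B u i (Suc i) \<omega> \<partial>P (Suc i))" .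
  have "exp (- (2 * a)) = exp (- a) * exp (- a)" for a :: real by (simp add: mult_exp_exp)
  then have "pr x * exp (- (2 * (q * total * u))) = c * exp (- (q * total * max 0 u))"
    using u unfolding c_def by simp
  then show ?thesis using main by (simp only: q_def)
qed

text \<open>The submartingale property. If the next arrival falls beyond the window, its location is
  irrelevant and the potential becomes 1; otherwise it avoids \<open>B\<close> with probability
  \<open>1 - q\<close> and the window shrinks by its wait. This is the recursion of
  \<open>exp_law_renewal\<close> with \<open>c = 1\<close>.\<close>

lemma gap_potential_step:
  assumes B: "B \<subseteq> X" and "i < n"
  shows "gap_potential x B u i n \<omega> \<le> (\<integral>\<^sup>+ w. (\<Sum>y\<in>X. ennreal (pr y) *
     gap_potential x B u i (Suc n) (\<omega> (n := (w, y)))) \<partial>exp_law total)"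
proof (cases "snd (\<omega> i) = x \<and> isolated B i n u \<omega>")
  case True
  define q where "q = (\<Sum>y\<in>B. pr y)"
  define S where "S = (\<Sum>j<n. fst (\<omega> j)) - arrival \<omega> i"
  have q: "0 \<le> q" "q \<le> 1" using sum_pr_subset[OF B] by (auto simp: q_def)
  define e where "e v = ennreal (exp (- (q * total * max 0 v)))" for v
  have upd: "gap_potential x B u i (Suc n) (\<omega> (n := (w, y))) =
      (if y \<in> B \<longrightarrow> u < \<bar>S + w\<bar> then e (u - S - w) else 0)" for w y
  proof -
    have ai: "arrival (\<omega> (n := (w, y))) i = arrival \<omega> i" using \<open>i < n\<close> by (rule arrival_upd_less)
    have sum: "(\<Sum>j<Suc n. fst ((\<omega> (n := (w, y))) j)) = (\<Sum>j<n. fst (\<omega> j)) + w"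
      by (simp only: sum.lessThan_Suc waits_upd) simp
    have sn: "snd ((\<omega> (n := (w, y))) k) = snd (\<omega> k)" if "k < n" for k
      using that by simp
    have snn: "snd ((\<omega> (n := (w, y))) n) = y" by simp
    have "isolated B i (Suc n) u (\<omega> (n := (w, y))) \<longleftrightarrow>
        isolated B i n u \<omega> \<and> (y \<in> B \<longrightarrow> u < \<bar>S + w\<bar>)"
    proof -
      have "arrival (\<omega> (n := (w, y))) n - arrival \<omega> i = S + w"
        unfolding arrival_upd_same S_def by simp
      then show ?thesis
        unfolding isolated_def ai less_Suc_eq using \<open>i < n\<close> snn sn
        by (auto simp del: fun_upd_apply arrival_upd_same)
    qed
    moreover have "u - ((\<Sum>j<n. fst (\<omega> j)) + w - arrival \<omega> i) = u - S - w" by (simp add: S_def)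
    ultimately show ?thesis
      using True sn[OF \<open>i < n\<close>] unfolding sum ai e_def q_def by auto
  qed
  have "ennreal (1 * exp (- (q * total * max 0 (u - S)))) \<le>
      (\<integral>\<^sup>+ w. (if u - S - w < 0 then 1 else ennreal (1 - q) * e (u - S - w)) \<partial>exp_law total)"
  proof (rule exp_law_renewal[where g = "\<lambda>v. if v < 0 then 1 else ennreal (1 - q) * e v"])
    show "ennreal (1 * ((1 - q) * exp (- (q * total * v)))) \<le> (if v < 0 then 1 else ennreal (1 - q) * e v)"
      if "0 \<le> v" for v
      using that q by (simp add: e_def ennreal_mult)
  qed (use total_pos q in auto)
  also have "\<dots> \<le> (\<integral>\<^sup>+ w. (\<Sum>y\<in>X. ennreal (pr y) *
     gap_potential x B u i (Suc n) (\<omega> (n := (w, y)))) \<partial>exp_law total)"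
  proof (intro nn_integral_mono)
    fix w
    show "(if u - S - w < 0 then 1 else ennreal (1 - q) * e (u - S - w)) \<le>
        (\<Sum>y\<in>X. ennreal (pr y) * gap_potential x B u i (Suc n) (\<omega> (n := (w, y))))"
    proof (cases "u - S - w < 0")
      case True
      then have "u < \<bar>S + w\<bar>" by linarith
      moreover have "e (u - S - w) = 1" using True by (simp add: e_def)
      ultimately show ?thesis using True unfolding upd
        by (simp add: sum_pr_const[where c = 1, simplified])
    next
      case False
      have "ennreal (1 - q) * e (u - S - w) = (\<Sum>y\<in>X. ennreal (pr y) * (if y \<in> B then 0 else e (u - S - w)))"
        unfolding q_def by (rule sum_pr_outside[OF B, symmetric])
      also have "\<dots> \<le> (\<Sum>y\<in>X. ennreal (pr y) * gap_potential x B u i (Suc n) (\<omega> (n := (w, y))))"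
        unfolding upd by (intro sum_mono mult_left_mono) auto
      finally show ?thesis using False by simp
    qed
  qed
  finally show ?thesis using True unfolding q_def S_def by simp
qed auto

lemma gap_potential_bound:
  assumes B: "B \<subseteq> X" and x: "x \<in> X" and u: "0 \<le> u" and "i < n"
  shows "ennreal (pr x * exp (- (2 * ((\<Sum>y\<in>B. pr y) * total * u)))) \<le>
     (\<integral>\<^sup>+ \<omega>. gap_potential x B u i n \<omega> \<partial>P n)"
  using \<open>i < n\<close>
proof (induction n)
  case (Suc n)
  show ?case
  proof (cases "i = n")
    case True
    show ?thesis unfolding True[symmetric] by (rule gap_potential_start[OF B x u])
  next
    case False
    then have "i < n" using Suc.prems by simp
    then have "ennreal (pr x * exp (- (2 * ((\<Sum>y\<in>B. pr y) * total * u)))) \<le>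
        (\<integral>\<^sup>+ \<omega>. gap_potential x B u i n \<omega> \<partial>P n)" by (rule Suc.IH)
    also have "\<dots> \<le> (\<integral>\<^sup>+ \<omega>. (\<integral>\<^sup>+ w. (\<Sum>y\<in>X. ennreal (pr y) *
        gap_potential x B u i (Suc n) (\<omega> (n := (w, y)))) \<partial>exp_law total) \<partial>P n)"
      by (intro nn_integral_mono gap_potential_step[OF B \<open>i < n\<close>])
    also have "\<dots> = (\<integral>\<^sup>+ \<omega>. gap_potential x B u i (Suc n) \<omega> \<partial>P (Suc n))"
      by (rule nn_integral_P_Suc[symmetric]) measurable
    finally show ?thesis .
  qed
qed simp

text \<open>The open ball has rate at most \<open>1 / rho x\<close>, and the final potential is at
  most the indicator of isolation, as its exponential factor does not exceed 1.\<close>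

lemma isolated_lower:
  assumes "x \<in> X" "0 \<le> u" "i < n"
  shows "ennreal (pr x * exp (- (2 * u / rho x))) \<le>
     (\<integral>\<^sup>+ \<omega>. (if snd (\<omega> i) = x \<and> isolated (inner x) i n u \<omega> then 1 else 0) \<partial>P n)"
proof -
  define q where "q = (\<Sum>y\<in>inner x. pr y)"
  have "q * total = (\<Sum>y\<in>inner x. rate y)"
    using total_pos by (simp add: q_def pr_def sum_divide_distrib[symmetric])
  then have "q * total \<le> 1 / rho x"
    using rho_inner[OF \<open>x \<in> X\<close>] rho_pos[OF \<open>x \<in> X\<close>] by (simp add: field_simps)
  then have "2 * (q * total * u) \<le> 2 * (1 / rho x * u)"
    using \<open>0 \<le> u\<close> by (intro mult_left_mono mult_right_mono) auto
  then have "ennreal (pr x * exp (- (2 * u / rho x))) \<le> ennreal (pr x * exp (- (2 * (q * total * u))))"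
    using pr_nonneg[OF \<open>x \<in> X\<close>] by (intro ennreal_leI mult_left_mono) auto
  also have "\<dots> \<le> (\<integral>\<^sup>+ \<omega>. gap_potential x (inner x) u i n \<omega> \<partial>P n)"
    unfolding q_def using assms inner_subset by (intro gap_potential_bound) auto
  also have "\<dots> \<le> (\<integral>\<^sup>+ \<omega>. (if snd (\<omega> i) = x \<and> isolated (inner x) i n u \<omega> then 1 else 0) \<partial>P n)"
  proof (intro nn_integral_mono)
    fix \<omega>
    have "0 \<le> q" unfolding q_def by (rule sum_pr_subset[OF inner_subset])
    then show "gap_potential x (inner x) u i n \<omega> \<le>
        (if snd (\<omega> i) = x \<and> isolated (inner x) i n u \<omega> then 1 else 0)"
      using total_pos by (auto simp: ennreal_le_1 q_def intro!: mult_nonneg_nonneg)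
  qed
  finally show ?thesis .
qed

end

section \<open>Bounds on the expected costs\<close>

text \<open>The expected optimum is not known to be finite here; if it is infinite, the quotient is
  0.\<close>

lemma divide_mono_ennreal_real:
  assumes "a \<le> ennreal a'" "ennreal b' \<le> b" "0 \<le> a'" "0 < b'"
  shows "a / b \<le> ennreal (a' / b')"
proof (cases b rule: ennreal_cases)
  case (real r)
  then have r: "b' \<le> r" "0 < r" using assms by (auto simp: ennreal_le_iff)
  have "a / b \<le> ennreal a' / ennreal r"
    using assms(1) real by (auto intro: divide_right_mono_ennreal)
  also have "\<dots> = ennreal (a' / r)" using assms r by (simp add: divide_ennreal)
  also have "\<dots> \<le> ennreal (a' / b')" using assms r by (intro ennreal_leI divide_left_mono) auto
  finally show ?thesis .
qed simp

lemma request_seq_simps: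
  "length (request_seq m \<omega>) = m"
  "i < m \<Longrightarrow> loc (request_seq m \<omega>) i = snd (\<omega> i)"
  "i < m \<Longrightarrow> arr (request_seq m \<omega>) i = arrival \<omega> i"
  by (auto simp: request_seq_def)

lemma arrival_strict_mono:
  assumes pos: "\<forall>k<m. 0 < fst (\<omega> k)" and "i < j" "j < m"
  shows "arrival \<omega> i < arrival \<omega> j"
proof (rule sum_strict_mono2)
  show "j \<in> {..j} - {..i}" using \<open>i < j\<close> by auto
qed (use assms in \<open>auto intro: less_imp_le\<close>)

context poisson_model
begin

section \<open>Integrating the pathwise bounds\<close>

lemma mpmd_input_request_seq:
  assumes "even m" "\<omega> \<in> space (P m)" "\<forall>k<m. 0 < fst (\<omega> k)"
  shows "mpmd_input X (request_seq m \<omega>)"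
proof -
  have "inj_on (arr (request_seq m \<omega>)) {..<m}"
  proof (rule inj_onI)
    fix i j assume ij: "i \<in> {..<m}" "j \<in> {..<m}" "arr (request_seq m \<omega>) i = arr (request_seq m \<omega>) j"
    then have "arrival \<omega> i = arrival \<omega> j" by (simp add: request_seq_simps)
    then show "i = j"
      using arrival_strict_mono[OF assms(3), of i j] arrival_strict_mono[OF assms(3), of j i] ij
      by (cases i j rule: linorder_cases) auto
  qed
  moreover have "0 \<le> arrival \<omega> i" if "i < m" for i
    using assms(3) that by (intro sum_nonneg) (auto intro: less_imp_le)
  ultimately show ?thesis
    using assms space_P[OF assms(2)] by (auto simp: mpmd_input_def request_seq_simps)
qed

lemma expected_greedy_le:
  assumes "even m" and greedy: "\<And>\<sigma>. mpmd_input X \<sigma> \<Longrightarrow> greedy_solution d \<sigma> (Greedy \<sigma>)"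
    and D: "\<And>x y. x \<in> X \<Longrightarrow> y \<in> X \<Longrightarrow> d x y \<le> D"
  shows "expected X rate m (\<lambda>\<sigma>. mpmd_cost d \<sigma> (Greedy \<sigma>))
     \<le> ennreal (4 * real m * mean_rho + 2 * (real (card X) * D))"
proof -
  define C where "C = 2 * (real (card X) * D)"
  obtain x where "x \<in> X" using X_nonempty by auto
  then have "0 \<le> D" using D[of x x] nonneg[of x x] by linarith
  then have C: "0 \<le> C" by (simp add: C_def)
  \<comment> \<open>The right-hand side is measurable, so from here on only monotonicity of the
    integral is applied to the Greedy cost. The bound holds almost everywhere because distinct,
    increasing arrival times require positive waits.\<close>
  have bound: "AE \<omega> in P m. ennreal (mpmd_cost d (request_seq m \<omega>) (Greedy (request_seq m \<omega>))) \<le>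
      2 * (\<Sum>i<m. ennreal (rho (snd (\<omega> i))) + ennreal (wait_potential \<omega> i m)) + ennreal C"
    using AE_wait_pos
  proof (rule AE_mp, intro AE_I2 impI)
    fix \<omega> assume \<omega>: "\<omega> \<in> space (P m)" and pos: "\<forall>k<m. 0 < fst (\<omega> k)"
    let ?\<sigma> = "request_seq m \<omega>"
    obtain M s where Ms: "Greedy ?\<sigma> = (M, s)" by (cases "Greedy ?\<sigma>")
    have G: "greedy_solution d ?\<sigma> (M, s)"
      using greedy[OF mpmd_input_request_seq[OF \<open>even m\<close> \<omega> pos]] Ms by simp
    have rho0: "0 \<le> rho (snd (\<omega> i))" if "i < m" for i
      using rho_pos[OF space_P[OF \<omega> that]] by simp
    have "mpmd_cost d ?\<sigma> (M, s) \<le>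
      2 * (\<Sum>i<length ?\<sigma>. rho (loc ?\<sigma> i) + excess (arr ?\<sigma>) (loc ?\<sigma>) {y \<in> X. d (loc ?\<sigma> i) y \<le> rho (loc ?\<sigma> i)}
            (arr ?\<sigma> i + rho (loc ?\<sigma> i)) i (length ?\<sigma>)) + 2 * (real (card X) * D)"
    proof (rule greedy_cost_le_excess[OF Metric_space_axioms finite_X G])
      show "arr ?\<sigma> i < arr ?\<sigma> j" if "i < j" "j < length ?\<sigma>" for i j
        using arrival_strict_mono[OF pos, of i j] that by (simp add: request_seq_simps)
    qed (use space_P[OF \<omega>] D rho_pos in \<open>auto simp: request_seq_simps less_imp_le\<close>)
    also have "\<dots> = 2 * (\<Sum>i<m. rho (snd (\<omega> i)) + excess_at \<omega> i m) + C"
    proof -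
      have "excess (arr ?\<sigma>) (loc ?\<sigma>) {y \<in> X. d (loc ?\<sigma> i) y \<le> rho (loc ?\<sigma> i)}
          (arr ?\<sigma> i + rho (loc ?\<sigma> i)) i m = excess_at \<omega> i m" if "i < m" for i
        unfolding request_seq_simps(2,3)[OF that] near_def
        by (rule excess_cong) (auto simp: request_seq_simps)
      then show ?thesis
        by (simp add: request_seq_simps C_def)
    qed
    also have "\<dots> \<le> 2 * (\<Sum>i<m. rho (snd (\<omega> i)) + wait_potential \<omega> i m) + C"
      using rho0 by (intro add_mono mult_left_mono sum_mono) auto
    finally have "ennreal (mpmd_cost d ?\<sigma> (M, s)) \<le>
        ennreal (2 * (\<Sum>i<m. rho (snd (\<omega> i)) + wait_potential \<omega> i m) + C)"
      by (rule ennreal_leI)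
    also have "\<dots> = 2 * ennreal (\<Sum>i<m. rho (snd (\<omega> i)) + wait_potential \<omega> i m) + ennreal C"
      using rho0 C excess_nonneg
      by (subst ennreal_plus) (auto intro!: sum_nonneg mult_nonneg_nonneg add_nonneg_nonneg simp: ennreal_mult')
    also have "ennreal (\<Sum>i<m. rho (snd (\<omega> i)) + wait_potential \<omega> i m) =
        (\<Sum>i<m. ennreal (rho (snd (\<omega> i)) + wait_potential \<omega> i m))"
      using rho0 excess_nonneg by (intro sum_ennreal[symmetric]) (auto intro!: add_nonneg_nonneg)
    also have "\<dots> = (\<Sum>i<m. ennreal (rho (snd (\<omega> i))) + ennreal (wait_potential \<omega> i m))"
      using rho0 excess_nonneg by (intro sum.cong refl ennreal_plus) (auto intro!: add_nonneg_nonneg)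
    finally show "ennreal (mpmd_cost d ?\<sigma> (Greedy ?\<sigma>)) \<le>
        2 * (\<Sum>i<m. ennreal (rho (snd (\<omega> i))) + ennreal (wait_potential \<omega> i m)) + ennreal C"
      by (simp only: Ms)
  qed
  have "expected X rate m (\<lambda>\<sigma>. mpmd_cost d \<sigma> (Greedy \<sigma>)) \<le>
      (\<integral>\<^sup>+ \<omega>. 2 * (\<Sum>i<m. ennreal (rho (snd (\<omega> i))) + ennreal (wait_potential \<omega> i m)) + ennreal C \<partial>P m)"
    unfolding expected_def by (rule nn_integral_mono_AE[OF bound])
  also have "\<dots> = 2 * (\<Sum>i<m. (\<integral>\<^sup>+ \<omega>. ennreal (rho (snd (\<omega> i))) \<partial>P m) +
      (\<integral>\<^sup>+ \<omega>. ennreal (wait_potential \<omega> i m) \<partial>P m)) + ennreal C"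
    by (simp add: nn_integral_add nn_integral_cmult nn_integral_sum)
  also have "\<dots> \<le> 2 * (\<Sum>i<m. ennreal mean_rho + ennreal mean_rho) + ennreal C"
    by (intro add_mono mult_left_mono sum_mono) (auto simp: nn_integral_rho wait_potential_bound)
  also have "\<dots> = ennreal (4 * real m * mean_rho + C)"
  proof -
    have "(\<Sum>i<m. ennreal mean_rho + ennreal mean_rho) = ennreal (\<Sum>i<m. mean_rho + mean_rho)"
      unfolding ennreal_plus[symmetric, OF less_imp_le[OF mean_rho_pos] less_imp_le[OF mean_rho_pos]]
      using mean_rho_pos by (intro sum_ennreal) simp
    moreover have "2 * ennreal a = ennreal (2 * a)" for a by (simp add: ennreal_mult')
    ultimately have "2 * (\<Sum>i<m. ennreal mean_rho + ennreal mean_rho) = ennreal (2 * (\<Sum>i<m. mean_rho + mean_rho))"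
      by (simp only:)
    then show ?thesis
      using mean_rho_pos C by (subst ennreal_plus) (auto simp: algebra_simps)
  qed
  finally show ?thesis by (simp add: C_def)
qed

text \<open>A layer-cake encoding: for \<open>x = snd (\<omega> i)\<close>, the integral over
  \<open>u\<close> is the time difference from request \<open>i\<close> to the nearest other request
  in the open ball, capped at \<open>rho x\<close>. For any other \<open>x\<close> it
  vanishes.\<close>

definition gap :: "nat \<Rightarrow> nat \<Rightarrow> 'a \<Rightarrow> (nat \<Rightarrow> real \<times> 'a) \<Rightarrow> real \<Rightarrow> ennreal" where
  "gap m i x \<omega> u = indicator {0..rho x} u *
     (if snd (\<omega> i) = x \<and> isolated (inner x) i m u \<omega> then 1 else 0)"

lemma measurable_gap [measurable (raw)]: "case_prod (gap m i x) \<in> borel_measurable (P m \<Otimes>\<^sub>M lborel)"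
proof -
  note [measurable (raw)] = measurable_compose[OF measurable_fst measurable_wait]
    measurable_compose[OF measurable_fst measurable_loc_mem]
    measurable_compose[OF measurable_fst measurable_loc_eq]
  show ?thesis unfolding gap_def isolated_def split_beta' by measurable
qed

lemma pair_P_lborel: "pair_sigma_finite (P m) lborel"
  using prob_space_imp_sigma_finite[OF prob_P] lborel.sigma_finite_measure_axioms
  by (simp add: pair_sigma_finite_def)

lemma nn_integral_gap_lower:
  assumes x: "x \<in> X" and "i < m"
  shows "ennreal (pr x * rho x * ((1 - exp (-2)) / 2)) \<le> (\<integral>\<^sup>+ \<omega>. (\<integral>\<^sup>+ u. gap m i x \<omega> u \<partial>lborel) \<partial>P m)"
proof -
  interpret pair_sigma_finite "P m" lborel by (rule pair_P_lborel)
  note r = rho_pos[OF x]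
  \<comment> \<open>An antiderivative of the isolation bound
    \<open>pr x * exp (- 2 * u / rho x)\<close>; between 0 and \<open>rho x\<close> it increases by
    \<open>pr x * rho x * (1 - exp (-2)) / 2\<close>.\<close>
  let ?F = "\<lambda>u. - (pr x * rho x / 2 * exp (- (2 * u / rho x)))"
  have "pr x * rho x * ((1 - exp (-2)) / 2) = ?F (rho x) - ?F 0"
    using r by (simp add: field_simps)
  then have "ennreal (pr x * rho x * ((1 - exp (-2)) / 2)) = ennreal (?F (rho x) - ?F 0)" by (simp only:)
  also have "\<dots> = (\<integral>\<^sup>+ u. ennreal (pr x * exp (- (2 * u / rho x))) * indicator {0..rho x} u \<partial>lborel)"
    using r pr_nonneg[OF x] by (intro nn_integral_FTC_Icc[symmetric])
      (auto intro!: derivative_eq_intros simp: has_real_derivative_iff_has_vector_derivative[symmetric])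
  also have "\<dots> \<le> (\<integral>\<^sup>+ u. (\<integral>\<^sup>+ \<omega>. gap m i x \<omega> u \<partial>P m) \<partial>lborel)"
  proof (intro nn_integral_mono)
    fix u
    have "(\<integral>\<^sup>+ \<omega>. gap m i x \<omega> u \<partial>P m) = indicator {0..rho x} u *
        (\<integral>\<^sup>+ \<omega>. (if snd (\<omega> i) = x \<and> isolated (inner x) i m u \<omega> then 1 else 0) \<partial>P m)"
      unfolding gap_def by (rule nn_integral_cmult) measurable
    then show "ennreal (pr x * exp (- (2 * u / rho x))) * indicator {0..rho x} u \<le>
        (\<integral>\<^sup>+ \<omega>. gap m i x \<omega> u \<partial>P m)"
      using isolated_lower[OF x _ \<open>i < m\<close>, of u] by (auto simp: indicator_def)
  qed
  also have "\<dots> = (\<integral>\<^sup>+ \<omega>. (\<integral>\<^sup>+ u. gap m i x \<omega> u \<partial>lborel) \<partial>P m)"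
    by (rule Fubini'[OF measurable_gap])
  finally show ?thesis .
qed

lemma sum_gap_le_OPT:
  assumes "even m" and \<omega>: "\<omega> \<in> space (P m)"
  shows "(\<Sum>i<m. \<Sum>x\<in>X. \<integral>\<^sup>+ u. gap m i x \<omega> u \<partial>lborel) \<le> ennreal (2 * OPT d (request_seq m \<omega>))"
proof -
  let ?\<sigma> = "request_seq m \<omega>"
  define g where "g i = (\<integral>\<^sup>+ u. gap m i (snd (\<omega> i)) \<omega> u \<partial>lborel)" for i
  \<comment> \<open>If every admissible \<open>u\<close> is at most \<open>c\<close>, the integrand
    is supported in \<open>{0..c}\<close>. With \<open>c = rho\<close> this gives finiteness, and
    with \<open>c\<close> the space-time distance to another request it gives the hypothesis of
    \<open>OPT_ge_nearest\<close>.\<close>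
  have le: "g i \<le> ennreal c" if "0 \<le> c"
      "\<And>u. 0 \<le> u \<Longrightarrow> u \<le> rho (snd (\<omega> i)) \<Longrightarrow> isolated (inner (snd (\<omega> i))) i m u \<omega> \<Longrightarrow> u \<le> c" for c i
  proof -
    have "g i \<le> (\<integral>\<^sup>+ u. indicator {0..c} u \<partial>lborel)"
      unfolding g_def gap_def using that by (intro nn_integral_mono) (auto simp: indicator_def)
    then show ?thesis using \<open>0 \<le> c\<close> by simp
  qed
  have fin: "ennreal (enn2real (g i)) = g i" if "i < m" for i
  proof -
    have "g i \<le> ennreal (rho (snd (\<omega> i)))"
      using rho_pos[OF space_P[OF \<omega> that]] by (intro le) auto
    then have "g i < top" using ennreal_less_top le_less_trans by blast
    then show ?thesis by simp
  qed
  have "(\<Sum>x\<in>X. \<integral>\<^sup>+ u. gap m i x \<omega> u \<partial>lborel) = g i" if "i < m" for i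
  proof -
    have "(\<Sum>x\<in>X. \<integral>\<^sup>+ u. gap m i x \<omega> u \<partial>lborel) = (\<Sum>x\<in>X. if x = snd (\<omega> i) then g i else 0)"
      by (intro sum.cong refl) (auto simp: g_def gap_def)
    then show ?thesis using finite_X space_P[OF \<omega> that] by simp
  qed
  then have "(\<Sum>i<m. \<Sum>x\<in>X. \<integral>\<^sup>+ u. gap m i x \<omega> u \<partial>lborel) = (\<Sum>i<m. ennreal (enn2real (g i)))"
    using fin by simp
  also have "\<dots> = ennreal (\<Sum>i<m. enn2real (g i))" by (intro sum_ennreal) auto
  also have "\<dots> \<le> ennreal (2 * OPT d ?\<sigma>)"
  proof (rule ennreal_leI)
    have "(\<Sum>i<length ?\<sigma>. enn2real (g i)) \<le> 2 * OPT d ?\<sigma>"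
    proof (rule OPT_ge_nearest)
      fix i j assume "i < length ?\<sigma>" "j < length ?\<sigma>" and "i \<noteq> j"
      then have i: "i < m" and j: "j < m" by (auto simp: request_seq_simps)
      let ?c = "d (loc ?\<sigma> i) (loc ?\<sigma> j) + \<bar>arr ?\<sigma> i - arr ?\<sigma> j\<bar>"
      have "g i \<le> ennreal ?c"
      proof (rule le)
        fix u assume u: "u \<le> rho (snd (\<omega> i))" "isolated (inner (snd (\<omega> i))) i m u \<omega>"
        show "u \<le> ?c"
        \<comment> \<open>Inside the open ball, isolation bounds \<open>u\<close> by the time
          difference; outside, the distance alone is at least \<open>rho\<close>, hence at least
          \<open>u\<close>.\<close>
        proof (cases "snd (\<omega> j) \<in> inner (snd (\<omega> i))")
          case True
          then have "u < \<bar>arrival \<omega> j - arrival \<omega> i\<bar>"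
            using u(2) j \<open>i \<noteq> j\<close> by (auto simp: isolated_def)
          then show ?thesis
            unfolding request_seq_simps(2,3)[OF i] request_seq_simps(2,3)[OF j]
            using nonneg[of "snd (\<omega> i)" "snd (\<omega> j)"] by linarith
        next
          case False
          then show ?thesis
            using u(1) i j space_P[OF \<omega> j] by (simp add: request_seq_simps inner_def)
        qed
      qed simp
      then show "enn2real (g i) \<le> ?c" by (intro enn2real_leI) simp
    qed (use \<open>even m\<close> commute in \<open>auto simp: request_seq_simps\<close>)
    then show "(\<Sum>i<m. enn2real (g i)) \<le> 2 * OPT d ?\<sigma>" by (simp add: request_seq_simps)
  qed
  finally show ?thesis .
qed

lemma expected_OPT_ge:
  assumes "even m"
  shows "ennreal (real m * mean_rho * ((1 - exp (-2)) / 4)) \<le> expected X rate m (OPT d)"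
proof -
  have [measurable]: "(\<lambda>\<omega>. \<integral>\<^sup>+ u. gap m i x \<omega> u \<partial>lborel) \<in> borel_measurable (P m)" for i x
    using lborel.borel_measurable_nn_integral[OF measurable_gap] .
  have c: "0 \<le> (1 - exp (-2 :: real)) / 2" by simp
  have "real m * mean_rho * ((1 - exp (-2)) / 4) =
      1 / 2 * (\<Sum>i<m. \<Sum>x\<in>X. pr x * rho x * ((1 - exp (-2)) / 2))"
  proof -
    have "(\<Sum>x\<in>X. pr x * rho x * ((1 - exp (-2)) / 2)) = mean_rho * ((1 - exp (-2)) / 2)"
      unfolding mean_rho_def sum_distrib_right ..
    then show ?thesis by simp
  qed
  also have "ennreal \<dots> = ennreal (1 / 2) * (\<Sum>i<m. \<Sum>x\<in>X. ennreal (pr x * rho x * ((1 - exp (-2)) / 2)))"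
  proof -
    have t: "0 \<le> pr x * rho x * ((1 - exp (-2)) / 2)" if "x \<in> X" for x
      using pr_nonneg[OF that] rho_pos[OF that] c by (intro mult_nonneg_nonneg) auto
    have "(\<Sum>i<m. \<Sum>x\<in>X. ennreal (pr x * rho x * ((1 - exp (-2)) / 2))) =
        (\<Sum>i<m. ennreal (\<Sum>x\<in>X. pr x * rho x * ((1 - exp (-2)) / 2)))"
      by (intro sum.cong refl sum_ennreal t)
    also have "\<dots> = ennreal (\<Sum>i<m. \<Sum>x\<in>X. pr x * rho x * ((1 - exp (-2)) / 2))"
      by (intro sum_ennreal sum_nonneg t)
    finally show ?thesis by (simp only: ennreal_mult'[symmetric])
  qed
  also have "\<dots> \<le> ennreal (1 / 2) * (\<Sum>i<m. \<Sum>x\<in>X. (\<integral>\<^sup>+ \<omega>. (\<integral>\<^sup>+ u. gap m i x \<omega> u \<partial>lborel) \<partial>P m))"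
    by (intro mult_left_mono sum_mono nn_integral_gap_lower) auto
  also have "\<dots> = (\<integral>\<^sup>+ \<omega>. ennreal (1 / 2) * (\<Sum>i<m. \<Sum>x\<in>X. \<integral>\<^sup>+ u. gap m i x \<omega> u \<partial>lborel) \<partial>P m)"
    by (simp add: nn_integral_cmult nn_integral_sum)
  also have "\<dots> \<le> (\<integral>\<^sup>+ \<omega>. ennreal (OPT d (request_seq m \<omega>)) \<partial>P m)"
  proof (intro nn_integral_mono)
    fix \<omega> assume "\<omega> \<in> space (P m)"
    then have "ennreal (1 / 2) * (\<Sum>i<m. \<Sum>x\<in>X. \<integral>\<^sup>+ u. gap m i x \<omega> u \<partial>lborel) \<le>
        ennreal (1 / 2) * ennreal (2 * OPT d (request_seq m \<omega>))"
      using sum_gap_le_OPT[OF assms] by (intro mult_left_mono) auto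
    also have "\<dots> = ennreal (OPT d (request_seq m \<omega>))"
      by (subst ennreal_mult'[symmetric]) auto
    finally show "ennreal (1 / 2) * (\<Sum>i<m. \<Sum>x\<in>X. \<integral>\<^sup>+ u. gap m i x \<omega> u \<partial>lborel) \<le>
        ennreal (OPT d (request_seq m \<omega>))" .
  qed
  finally show ?thesis by (simp add: expected_def)
qed

end

theorem theorem1:
  fixes X :: "'a set" and d :: "'a \<Rightarrow> 'a \<Rightarrow> real" and rate :: "'a \<Rightarrow> real"
    and Greedy :: "'a requests \<Rightarrow> solution"
  assumes "Metric_space X d" and "finite X" and "X \<noteq> {}"
    and "\<And>x. x \<in> X \<Longrightarrow> rate x > 0"
    and "\<And>\<sigma>. mpmd_input X \<sigma> \<Longrightarrow> greedy_solution d \<sigma> (Greedy \<sigma>)"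
  shows "limsup (\<lambda>k. expected X rate (2 * k) (\<lambda>\<sigma>. mpmd_cost d \<sigma> (Greedy \<sigma>))
                   / expected X rate (2 * k) (OPT d))
         \<le> ennreal (16 / (1 - exp (-2)))"
proof -
  interpret poisson_model X d rate
    using assms by (simp add: poisson_model_def poisson_model_axioms_def)
  define D where "D = Max (case_prod d ` (X \<times> X))"
  have D: "d x y \<le> D" if "x \<in> X" "y \<in> X" for x y
    unfolding D_def using finite_X that by (intro Max_ge) force+
  define r where "r = mean_rho"
  define C where "C = 2 * (real (card X) * D)"
  define c :: real where "c = 1 - exp (-2)"
  have pos: "0 < r" "0 < c" using mean_rho_pos by (auto simp: r_def c_def)
  obtain x where "x \<in> X" using X_nonempty by auto
  then have "0 \<le> D" using D[of x x] nonneg[of x x] by linarith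
  then have C: "0 \<le> C" by (simp add: C_def)
  have "eventually (\<lambda>k. expected X rate (2 * k) (\<lambda>\<sigma>. mpmd_cost d \<sigma> (Greedy \<sigma>))
      / expected X rate (2 * k) (OPT d) \<le> ennreal ((8 * real k * r + C) / (2 * real k * r * (c / 4)))) sequentially"
    using eventually_gt_at_top[of 0]
  proof eventually_elim
    case (elim k)
    show ?case
    proof (rule divide_mono_ennreal_real)
      show "expected X rate (2 * k) (\<lambda>\<sigma>. mpmd_cost d \<sigma> (Greedy \<sigma>)) \<le> ennreal (8 * real k * r + C)"
        using expected_greedy_le[of "2 * k" Greedy D] assms(5) D by (simp add: r_def C_def)
      show "ennreal (2 * real k * r * (c / 4)) \<le> expected X rate (2 * k) (OPT d)"
        using expected_OPT_ge[of "2 * k"] by (simp add: r_def c_def)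
    qed (use pos C elim in auto)
  qed
  then have "limsup (\<lambda>k. expected X rate (2 * k) (\<lambda>\<sigma>. mpmd_cost d \<sigma> (Greedy \<sigma>))
      / expected X rate (2 * k) (OPT d))
      \<le> limsup (\<lambda>k. ennreal ((8 * real k * r + C) / (2 * real k * r * (c / 4))))"
    by (rule Limsup_mono)
  also have "\<dots> = ennreal (16 / c)"
  proof (rule lim_imp_Limsup, simp, rule tendsto_ennrealI)
    \<comment> \<open>With \<open>m = 2 * k\<close> the cost bounds are \<open>8 * k * r + C\<close>
      and \<open>k * r * c / 2\<close>; the constant \<open>C\<close>, due to the requests left
      after the last arrival, contributes only a term of order \<open>1 / k\<close>.\<close>
    have "(\<lambda>k. 16 / c + 2 * C / (r * c) * (1 / real k)) \<longlonglongrightarrow> 16 / c + 2 * C / (r * c) * 0"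
      by (intro tendsto_intros lim_1_over_n)
    moreover have "eventually (\<lambda>k. 16 / c + 2 * C / (r * c) * (1 / real k) =
        (8 * real k * r + C) / (2 * real k * r * (c / 4))) sequentially"
      using eventually_gt_at_top[of 0] by eventually_elim (use pos in \<open>simp add: field_simps\<close>)
    ultimately show "(\<lambda>k. (8 * real k * r + C) / (2 * real k * r * (c / 4))) \<longlonglongrightarrow> 16 / c"
      using Lim_transform_eventually by fastforce
  qed
  finally show ?thesis by (simp add: c_def)
qed

end
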